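(* Let $X$ be a Banach space with a normalized $1$-unconditional basis $(e_i)_i$ not equivalent to the standard basis of $c_0$, let $q\le p$ in $[1,\infty]$, $q<\infty$, be such that $X$ satisfies lower $p$ and upper $q$ estimates on block sequences with constant one, and let $X_k=\mathrm{span}\{e_1,\dots,e_k\}$. Let $d\in\mathbb{N}$ and let $P\subseteq\mathbb{N}$ and $M=\{k_j\}_{j=1}^\infty\subseteq\mathbb{N}$ satisfy Assumption $A(d,\tfrac12)$. Then for any $k>k_{2d}$ and any step preserving continuous map $F\colon S_{\ell_\infty^k}\to S_{X_k}$ with $F(1,\dots,1)\ne F(-1,\dots,-1)$, we have $\omega_F(\tfrac1d)\ge\tfrac12$. In particular, there is no sequence $(F_k\colon S_{\ell_\infty^k}\to S_{X_k})_k$ of equi-uniformly continuous step preserving homeomorphisms.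
   Context: Identify $X_k$ with $\mathbb{R}^k$ via $(e_i)$; $1_A=\sum_{i\in A}e_i$; $S_{X_k}$ is the unit sphere of $X_k$ in $\|\cdot\|_X$, $S_{\ell_\infty^k}$ that of $(\mathbb{R}^k,\|\cdot\|_\infty)$. $\psi(k)=\|1_{[1,k]}\|_X$; $\psi_P(k)=\min\{\|1_{[1,k]\cap P}\|_X,\|1_{[1,k]\cap P^c}\|_X\}$. Lower $p$/upper $q$ estimates with constant one: $(\sum\|x_i\|^p)^{1/p}\le\|\sum x_i\|\le(\sum\|x_i\|^q)^{1/q}$ for every block sequence $(x_i)$ (vectors supported on successive disjoint intervals of indices). Assumption $A(d,\varepsilon)$ for $P$ and $M=\{k_j\}$ ($k_1<k_2<\cdots$): (i) $\psi_P(k)\ge\frac12(\psi(k)-1)$ for all $k$; (ii) $(k_j,k_{j+1}]\cap P\ne\emptyset$ and $(k_j,k_{j+1}]\cap P^c\ne\emptyset$ for all $j$; (iii) $\psi(k_{j+1})\ge(\frac{8d^{1/q-1/p}}{\varepsilon}+2)\psi(k_j)+1$ for all $j$. $F=(F_i)$ (coefficients of $e_i$) is step preserving if $x_i=x_j$ implies $F_i(x)=F_j(x)$. $\omega_F(t)=\sup\{\|F(x)-F(y)\|_X:\|x-y\|_\infty\le t\}$; equi-uniform continuity of $(F_k)$: for every $\varepsilon>0$ there is $\delta>0$ with $\omega_{F_k}(\delta)<\varepsilon$ for all $k$. *)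

theory Defs
  imports Complex_Main "HOL-Library.Extended_Real"
begin

text \<open>Vectors are real sequences indexed by nat; the basis vectors e_i are indexed by i >= 1
  (coordinate 0 is unused and forced to be 0).  c00 = finitely supported vectors.\<close>

definition c00 :: "(nat \<Rightarrow> real) set" where
  "c00 = {x. finite {i. x i \<noteq> 0} \<and> x 0 = 0}"

definition unitv :: "nat \<Rightarrow> nat \<Rightarrow> real" where
  "unitv n = (\<lambda>i. if i = n then 1 else 0)"

definition ind :: "nat set \<Rightarrow> nat \<Rightarrow> real" where
  "ind A = (\<lambda>i. if i \<in> A then 1 else 0)"

definition supn :: "(nat \<Rightarrow> real) \<Rightarrow> real" where
  "supn x = Sup (range (\<lambda>i. \<bar>x i\<bar>))"

text \<open>X is given by its norm N on c00 (which determines X as the completion).\<close>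
definition norm_on_c00 :: "((nat \<Rightarrow> real) \<Rightarrow> real) \<Rightarrow> bool" where
  "norm_on_c00 N \<longleftrightarrow>
     (\<forall>x\<in>c00. N x \<ge> 0 \<and> (N x = 0 \<longleftrightarrow> x = (\<lambda>_. 0))) \<and>
     (\<forall>x\<in>c00. \<forall>c. N (\<lambda>i. c * x i) = \<bar>c\<bar> * N x) \<and>
     (\<forall>x\<in>c00. \<forall>y\<in>c00. N (\<lambda>i. x i + y i) \<le> N x + N y)"

definition normalized_1_unconditional :: "((nat \<Rightarrow> real) \<Rightarrow> real) \<Rightarrow> bool" where
  "normalized_1_unconditional N \<longleftrightarrow>
     (\<forall>n\<ge>1. N (unitv n) = 1) \<and>
     (\<forall>x\<in>c00. \<forall>\<epsilon>. (\<forall>i. \<bar>\<epsilon> i\<bar> = 1) \<longrightarrow> N (\<lambda>i. \<epsilon> i * x i) = N x)"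

definition equiv_c0 :: "((nat \<Rightarrow> real) \<Rightarrow> real) \<Rightarrow> bool" where
  "equiv_c0 N \<longleftrightarrow> (\<exists>C>0. \<forall>x\<in>c00. N x \<le> C * supn x \<and> supn x \<le> C * N x)"

definition block_seq :: "(nat \<Rightarrow> real) list \<Rightarrow> bool" where
  "block_seq xs \<longleftrightarrow> (\<forall>x\<in>set xs. x \<in> c00) \<and>
     (\<forall>i j a b. i < j \<longrightarrow> j < length xs \<longrightarrow> (xs!i) a \<noteq> 0 \<longrightarrow> (xs!j) b \<noteq> 0 \<longrightarrow> a < b)"

definition lpsum :: "ereal \<Rightarrow> real list \<Rightarrow> real" where
  "lpsum p xs = (if p = \<infinity> then Max (insert 0 (set xs))
                 else (\<Sum>a\<leftarrow>xs. a powr real_of_ereal p) powr (1 / real_of_ereal p))"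

definition vsum :: "(nat \<Rightarrow> real) list \<Rightarrow> nat \<Rightarrow> real" where
  "vsum xs = (\<lambda>i. \<Sum>x\<leftarrow>xs. x i)"

definition lower_upper_est :: "((nat \<Rightarrow> real) \<Rightarrow> real) \<Rightarrow> ereal \<Rightarrow> real \<Rightarrow> bool" where
  "lower_upper_est N p q \<longleftrightarrow> (\<forall>xs. block_seq xs \<longrightarrow>
      lpsum p (map N xs) \<le> N (vsum xs) \<and> N (vsum xs) \<le> lpsum (ereal q) (map N xs))"

definition inv_e :: "ereal \<Rightarrow> real" where
  "inv_e p = (if p = \<infinity> then 0 else 1 / real_of_ereal p)"

definition psi :: "((nat \<Rightarrow> real) \<Rightarrow> real) \<Rightarrow> nat \<Rightarrow> real" where
  "psi N k = N (ind {1..k})"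

definition psiP :: "((nat \<Rightarrow> real) \<Rightarrow> real) \<Rightarrow> nat set \<Rightarrow> nat \<Rightarrow> real" where
  "psiP N P k = min (N (ind ({1..k} \<inter> P))) (N (ind ({1..k} - P)))"

text \<open>Assumption A(d,eps) for P and M = {k_1 < k_2 < ...} (sequence kk indexed from 1).\<close>
definition assumptionA ::
  "((nat \<Rightarrow> real) \<Rightarrow> real) \<Rightarrow> ereal \<Rightarrow> real \<Rightarrow> nat \<Rightarrow> real \<Rightarrow> nat set \<Rightarrow> (nat \<Rightarrow> nat) \<Rightarrow> bool" where
  "assumptionA N p q d eps P kk \<longleftrightarrow>
     (\<forall>j\<ge>1. kk j < kk (j+1)) \<and>
     (\<forall>k. psiP N P k \<ge> (psi N k - 1) / 2) \<and>
     (\<forall>j\<ge>1. {kk j<..kk (j+1)} \<inter> P \<noteq> {} \<and> {kk j<..kk (j+1)} - P \<noteq> {}) \<and>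
     (\<forall>j\<ge>1. psi N (kk (j+1)) \<ge>
        (8 * real d powr (1/q - inv_e p) / eps + 2) * psi N (kk j) + 1)"

definition Xk :: "nat \<Rightarrow> (nat \<Rightarrow> real) set" where
  "Xk k = {x. \<forall>i. i \<notin> {1..k} \<longrightarrow> x i = 0}"

definition S_linf :: "nat \<Rightarrow> (nat \<Rightarrow> real) set" where
  "S_linf k = {x \<in> Xk k. supn x = 1}"

definition S_X :: "((nat \<Rightarrow> real) \<Rightarrow> real) \<Rightarrow> nat \<Rightarrow> (nat \<Rightarrow> real) set" where
  "S_X N k = {x \<in> Xk k. N x = 1}"

definition vdiff :: "(nat \<Rightarrow> real) \<Rightarrow> (nat \<Rightarrow> real) \<Rightarrow> nat \<Rightarrow> real" where
  "vdiff x y = (\<lambda>i. x i - y i)"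

definition step_preserving :: "nat \<Rightarrow> ((nat \<Rightarrow> real) \<Rightarrow> (nat \<Rightarrow> real)) \<Rightarrow> bool" where
  "step_preserving k F \<longleftrightarrow>
     (\<forall>x\<in>S_linf k. \<forall>i\<in>{1..k}. \<forall>j\<in>{1..k}. x i = x j \<longrightarrow> F x i = F x j)"

definition cont_map :: "((nat \<Rightarrow> real) \<Rightarrow> real) \<Rightarrow> nat \<Rightarrow> ((nat \<Rightarrow> real) \<Rightarrow> (nat \<Rightarrow> real)) \<Rightarrow> bool" where
  "cont_map N k F \<longleftrightarrow> (\<forall>x\<in>S_linf k. \<forall>e>0. \<exists>\<delta>>0. \<forall>y\<in>S_linf k.
      supn (vdiff x y) < \<delta> \<longrightarrow> N (vdiff (F x) (F y)) < e)"

definition cont_inv :: "((nat \<Rightarrow> real) \<Rightarrow> real) \<Rightarrow> nat \<Rightarrow> ((nat \<Rightarrow> real) \<Rightarrow> (nat \<Rightarrow> real)) \<Rightarrow> bool" where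
  "cont_inv N k G \<longleftrightarrow> (\<forall>x\<in>S_X N k. \<forall>e>0. \<exists>\<delta>>0. \<forall>y\<in>S_X N k.
      N (vdiff x y) < \<delta> \<longrightarrow> supn (vdiff (G x) (G y)) < e)"

definition homeo_spheres :: "((nat \<Rightarrow> real) \<Rightarrow> real) \<Rightarrow> nat \<Rightarrow> ((nat \<Rightarrow> real) \<Rightarrow> (nat \<Rightarrow> real)) \<Rightarrow> bool" where
  "homeo_spheres N k F \<longleftrightarrow> bij_betw F (S_linf k) (S_X N k) \<and> cont_map N k F \<and>
      cont_inv N k (inv_into (S_linf k) F)"

definition omega :: "((nat \<Rightarrow> real) \<Rightarrow> real) \<Rightarrow> nat \<Rightarrow> ((nat \<Rightarrow> real) \<Rightarrow> (nat \<Rightarrow> real)) \<Rightarrow> real \<Rightarrow> real" where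
  "omega N k F t = Sup {N (vdiff (F x) (F y)) | x y. x \<in> S_linf k \<and> y \<in> S_linf k \<and> supn (vdiff x y) \<le> t}"

end

theory Submission
  imports Defs "HOL-Analysis.Convex" "HOL-Analysis.Elementary_Metric_Spaces"
begin

text \<open>For \<open>w\<close> with \<open>|w i| \<le> 1\<close> attaining both values \<open>\<plusminus>1\<close>, the curve
  \<open>v \<mapsto> v + (1 - |v|) w\<close>, \<open>-1 \<le> v \<le> 1\<close>, runs in the unit sphere of
  \<open>\<ell>\<^sub>\<infinity>\<close> from \<open>-(1,...,1)\<close> to \<open>(1,...,1)\<close>. The images of the endpoints are
  opposite multiples of \<open>(1,...,1)\<close>, so \<open>F\<close> vanishes on the coordinates with \<open>w i = 0\<close> at some
  point \<open>x\<close> of the curve. Let \<open>w\<close> be a staircase descending from \<open>\<plusminus>1\<close> to \<open>0\<close> in steps of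
  length \<open>1/d\<close> along the blocks between consecutive \<open>k\<^sub>j\<close>, in which one half of every block
  lags one step behind the other half, and let \<open>w'\<close> be the staircase in which the two halves
  have exchanged their roles; \<open>y\<close> is the corresponding point on the curve of \<open>w'\<close>. Every value
  that \<open>F x\<close> takes on a leading half is also its value on a lagging half in the preceding block,
  whose norm is much smaller, so \<open>F x\<close> is concentrated on the leading halves. In the same way
  \<open>F y\<close> is concentrated off this set, whence \<open>N (F x - F y) \<ge> 1/2\<close>, although
  \<open>x\<close> and \<open>y\<close> are \<open>1/d\<close> apart. This needs \<open>d \<ge> 2\<close>; for \<open>d = 1\<close> three steps of length \<open>1\<close>
  lead from \<open>(1,...,1)\<close> to \<open>-(1,...,1)\<close>. The equi-uniform case follows because \<open>psi\<close> is
  unbounded, so that sufficiently sparse \<open>k\<^sub>j\<close> exist for every \<open>d\<close>.\<close>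

subsection \<open>Power means\<close>

text \<open>Weighted arithmetic-geometric mean inequality against the mean \<open>M\<close> of the
  r-th powers: with this normalisation the summed right-hand side collapses to
  \<open>n * M\<close>.\<close>

lemma power_mean_le:
  fixes a :: "'b \<Rightarrow> real" and q r :: real
  assumes fin: "finite S" and a: "\<And>i. i \<in> S \<Longrightarrow> 0 \<le> a i" and q: "0 < q" and qr: "q \<le> r"
  shows "(\<Sum>i\<in>S. a i powr q) powr (1/q)
    \<le> real (card S) powr (1/q - 1/r) * (\<Sum>i\<in>S. a i powr r) powr (1/r)"
proof (cases "(\<Sum>i\<in>S. a i powr r) = 0")
  case True
  then have "\<forall>i\<in>S. a i powr r = 0"
    using fin by (subst (asm) sum_nonneg_eq_0_iff) auto
  then have "(\<Sum>i\<in>S. a i powr q) = 0"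
    by (intro sum.neutral) auto
  then show ?thesis by simp
next
  case False
  define \<Sigma> where "\<Sigma> = (\<Sum>i\<in>S. a i powr r)"
  define n where "n = real (card S)"
  define M where "M = \<Sigma> / n"
  have S: "0 < \<Sigma>"
    using False unfolding \<Sigma>_def by (simp add: order_less_le sum_nonneg)
  have "S \<noteq> {}" using False by auto
  then have n: "0 < n" unfolding n_def using fin by (simp add: card_gt_0_iff)
  have M: "0 < M" using S n by (simp add: M_def)
  have r: "0 < r" using q qr by simp
  have young: "a i powr q * M powr (1 - q/r) \<le> q/r * a i powr r + (1 - q/r) * M" if "i \<in> S" for i
  proof (cases "a i = 0")
    case True
    have "0 \<le> (1 - q/r) * M" using M r qr by (simp add: field_simps)
    then show ?thesis using True by simp
  next
    case False
    then have "0 < a i" using a[OF that] by simp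
    then have "(a i powr r) powr (q/r) * M powr (1 - q/r) \<le> q/r * a i powr r + (1 - q/r) * M"
      using M r q qr by (intro Youngs_inequality_0) (auto simp: field_simps)
    then show ?thesis using r by (simp add: powr_powr)
  qed
  have "(\<Sum>i\<in>S. a i powr q) * M powr (1 - q/r) \<le> (\<Sum>i\<in>S. q/r * a i powr r + (1 - q/r) * M)"
    unfolding sum_distrib_right by (intro sum_mono young)
  also have "\<dots> = q/r * \<Sigma> + n * ((1 - q/r) * M)"
    by (simp add: sum.distrib sum_distrib_left \<Sigma>_def n_def)
  also have "\<dots> = n * M"
    using n by (simp add: M_def algebra_simps)
  also have "n * M = n * M powr (q/r) * M powr (1 - q/r)"
    using M by (simp flip: powr_add)
  finally have "(\<Sum>i\<in>S. a i powr q) \<le> n * M powr (q/r)"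
    using M by simp
  then have "(\<Sum>i\<in>S. a i powr q) powr (1/q) \<le> (n * M powr (q/r)) powr (1/q)"
    using q by (intro powr_mono2) (auto intro: sum_nonneg)
  also have "\<dots> = n powr (1/q) * (\<Sigma>/n) powr (1/r)"
    using q n M by (simp add: powr_mult powr_powr M_def)
  also have "\<dots> = n powr (1/q - 1/r) * \<Sigma> powr (1/r)"
    using n S by (simp add: powr_divide powr_diff)
  finally show ?thesis unfolding \<Sigma>_def n_def .
qed

lemma lpsum_mono:
  assumes "\<And>i. i < n \<Longrightarrow> 0 \<le> a i" "\<And>i. i < n \<Longrightarrow> a i \<le> b i" "0 < q"
  shows "lpsum (ereal q) (map a [0..<n]) \<le> lpsum (ereal q) (map b [0..<n])"
  using assms unfolding lpsum_def
  by (auto simp: sum_list_sum_nth comp_def intro!: powr_mono2 sum_mono sum_nonneg)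

lemma lpsum_cmult:
  assumes "0 \<le> c" "0 < q" "\<And>i. i < n \<Longrightarrow> 0 \<le> a i"
  shows "lpsum (ereal q) (map (\<lambda>i. c * a i) [0..<n]) = c * lpsum (ereal q) (map a [0..<n])"
proof -
  have "(\<Sum>i = 0..<n. (c * a i) powr q) = c powr q * (\<Sum>i = 0..<n. a i powr q)"
    unfolding sum_distrib_left using assms by (intro sum.cong) (auto simp: powr_mult)
  then show ?thesis
    using assms unfolding lpsum_def
    by (simp add: sum_list_sum_nth comp_def powr_mult powr_powr sum_nonneg)
qed

text \<open>Source of the factor \<open>d\<close> to the power 1/q - 1/p. For infinite
  \<open>p\<close> every term is bounded by the maximum, otherwise the power mean inequality
  applies; the exponent is nonnegative, so \<open>n\<close> may be enlarged to
  \<open>d\<close>.\<close>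

lemma lpsum_le_lpsum:
  assumes a: "\<And>i. i < n \<Longrightarrow> 0 \<le> a i" and q: "1 \<le> q" and qp: "ereal q \<le> p"
    and nd: "n \<le> d"
  shows "lpsum (ereal q) (map a [0..<n])
    \<le> real d powr (1/q - inv_e p) * lpsum p (map a [0..<n])"
proof (cases "n = 0")
  case True
  then show ?thesis by (simp add: lpsum_def)
next
  case False
  have mono: "real n powr s \<le> real d powr s" if "0 \<le> s" for s
    using that nd by (intro powr_mono2) auto
  have q_eq: "lpsum (ereal q) (map a [0..<n]) = (\<Sum>i\<in>{0..<n}. a i powr q) powr (1/q)"
    by (simp add: lpsum_def sum_list_sum_nth comp_def)
  consider "p = \<infinity>" | r where "p = ereal r" "q \<le> r"
    using qp by (cases p) auto
  then show ?thesis
  proof cases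
    case 1
    define M where "M = Max (insert 0 (a ` {0..<n}))"
    have M: "0 \<le> M" "\<And>i. i < n \<Longrightarrow> a i \<le> M" unfolding M_def by (auto intro!: Max_ge simp del: Max_insert)
    have "(\<Sum>i\<in>{0..<n}. a i powr q) \<le> (\<Sum>i\<in>{0..<n}. M powr q)"
      using a M q by (intro sum_mono powr_mono2) auto
    then have "(\<Sum>i\<in>{0..<n}. a i powr q) powr (1/q) \<le> (real n * M powr q) powr (1/q)"
      using q by (intro powr_mono2) (auto intro: sum_nonneg)
    also have "\<dots> = real n powr (1/q) * M"
      using q M by (simp add: powr_mult powr_powr)
    also have "\<dots> \<le> real d powr (1/q) * M"
      using q M by (intro mult_right_mono mono) auto
    finally show ?thesis
      unfolding q_eq using 1 by (simp add: lpsum_def inv_e_def M_def)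
  next
    case 2
    have "(\<Sum>i\<in>{0..<n}. a i powr q) powr (1/q)
        \<le> real n powr (1/q - 1/r) * (\<Sum>i\<in>{0..<n}. a i powr r) powr (1/r)"
      using power_mean_le[of "{0..<n}" a q r] a q 2 by simp
    also have "\<dots> \<le> real d powr (1/q - 1/r) * (\<Sum>i\<in>{0..<n}. a i powr r) powr (1/r)"
      using q 2 by (intro mult_right_mono mono) (auto simp: field_simps)
    finally show ?thesis
      unfolding q_eq using 2 by (simp add: lpsum_def inv_e_def sum_list_sum_nth comp_def)
  qed
qed

subsection \<open>Unconditional norms\<close>

definition restr :: "(nat \<Rightarrow> real) \<Rightarrow> nat set \<Rightarrow> nat \<Rightarrow> real" where
  "restr x A = (\<lambda>i. if i \<in> A then x i else 0)"

lemma ind_c00: "finite A \<Longrightarrow> 0 \<notin> A \<Longrightarrow> ind A \<in> c00"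
  unfolding c00_def ind_def by (auto elim: rev_finite_subset)

lemma restr_c00: "x \<in> c00 \<Longrightarrow> restr x A \<in> c00"
  unfolding c00_def restr_def by (auto elim: rev_finite_subset)

lemma vdiff_c00: "x \<in> c00 \<Longrightarrow> y \<in> c00 \<Longrightarrow> vdiff x y \<in> c00"
proof -
  assume "x \<in> c00" "y \<in> c00"
  moreover have "{i. vdiff x y i \<noteq> 0} \<subseteq> {i. x i \<noteq> 0} \<union> {i. y i \<noteq> 0}"
    by (auto simp: vdiff_def)
  ultimately show ?thesis
    unfolding c00_def by (auto simp: vdiff_def dest: finite_subset)
qed

lemma Xk_c00: "x \<in> Xk k \<Longrightarrow> x \<in> c00"
proof -
  assume x: "x \<in> Xk k"
  then have "{i. x i \<noteq> 0} \<subseteq> {1..k}" unfolding Xk_def by blast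
  then show ?thesis using x by (auto simp: c00_def Xk_def dest: finite_subset)
qed

lemma restr_vdiff: "restr (vdiff x y) A = vdiff (restr x A) (restr y A)"
  by (auto simp: restr_def vdiff_def)

locale unconditional_norm =
  fixes N :: "(nat \<Rightarrow> real) \<Rightarrow> real"
  assumes norm: "norm_on_c00 N" and uncond: "normalized_1_unconditional N"
begin

lemma N_nonneg: "x \<in> c00 \<Longrightarrow> 0 \<le> N x"
  using norm unfolding norm_on_c00_def by blast

lemma N_scale: "x \<in> c00 \<Longrightarrow> N (\<lambda>i. c * x i) = \<bar>c\<bar> * N x"
  using norm unfolding norm_on_c00_def by blast

lemma N_add_le: "x \<in> c00 \<Longrightarrow> y \<in> c00 \<Longrightarrow> N (\<lambda>i. x i + y i) \<le> N x + N y"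
  using norm unfolding norm_on_c00_def by blast

lemma N_zero: "N (\<lambda>_. 0) = 0"
  using norm unfolding norm_on_c00_def c00_def by auto

lemma N_signs: "x \<in> c00 \<Longrightarrow> (\<And>i. \<bar>s i\<bar> = 1) \<Longrightarrow> N (\<lambda>i. s i * x i) = N x"
  using uncond unfolding normalized_1_unconditional_def by blast

lemma N_uminus: "x \<in> c00 \<Longrightarrow> N (\<lambda>i. - x i) = N x"
  using N_scale[of x "-1"] by simp

lemma N_vdiff_le: "x \<in> c00 \<Longrightarrow> y \<in> c00 \<Longrightarrow> N (vdiff x y) \<le> N x + N y"
  using N_add_le[of x "\<lambda>i. - y i"] N_uminus[of y]
  by (simp add: vdiff_def c00_def)

lemma N_vdiff_commute: "x \<in> c00 \<Longrightarrow> y \<in> c00 \<Longrightarrow> N (vdiff x y) = N (vdiff y x)"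
  using N_uminus[OF vdiff_c00, of x y] by (simp add: vdiff_def)

lemma N_le_vdiff: "x \<in> c00 \<Longrightarrow> y \<in> c00 \<Longrightarrow> N x \<le> N (vdiff x y) + N y"
  using N_add_le[OF vdiff_c00, of x y y] by (simp add: vdiff_def)

lemma N_vdiff_triangle:
  assumes "x \<in> c00" "y \<in> c00" "z \<in> c00"
  shows "N (vdiff x z) \<le> N (vdiff x y) + N (vdiff y z)"
  using N_add_le[of "vdiff x y" "vdiff y z"] assms by (simp add: vdiff_c00) (simp add: vdiff_def)

text \<open>Scaling one coordinate by \<open>c \<in> [-1,1]\<close> is a convex combination of doing nothing and
  flipping the sign of that coordinate.\<close>
lemma N_shrink_coordinate:
  assumes x: "x \<in> c00" and c: "\<bar>c\<bar> \<le> 1"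
  shows "N (x(n := c * x n)) \<le> N x"
proof -
  define s :: "nat \<Rightarrow> real" where "s = (\<lambda>i. if i = n then -1 else 1)"
  have sx: "(\<lambda>i. s i * x i) \<in> c00" using x by (simp add: c00_def s_def)
  have Ns: "N (\<lambda>i. s i * x i) = N x" by (rule N_signs[OF x]) (simp add: s_def)
  have c00: "(\<lambda>i. (1+c)/2 * x i) \<in> c00" "(\<lambda>i. (1-c)/2 * (s i * x i)) \<in> c00"
    using x sx unfolding c00_def by (auto elim: rev_finite_subset)
  have "x(n := c * x n) = (\<lambda>i. (1+c)/2 * x i + (1-c)/2 * (s i * x i))"
    by (auto simp: s_def field_simps)
  then have "N (x(n := c * x n)) \<le> N (\<lambda>i. (1+c)/2 * x i) + N (\<lambda>i. (1-c)/2 * (s i * x i))"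
    using N_add_le[OF c00] by (simp only:)
  also have "\<dots> = \<bar>(1+c)/2\<bar> * N x + \<bar>(1-c)/2\<bar> * N x"
    by (simp only: N_scale[OF x] N_scale[OF sx] Ns)
  also have "\<bar>(1+c)/2\<bar> = (1+c)/2" using c by simp
  also have "\<bar>(1-c)/2\<bar> = (1-c)/2" using c by simp
  also have "(1+c)/2 * N x + (1-c)/2 * N x = N x" by (simp add: field_simps)
  finally show ?thesis .
qed

text \<open>\<open>y\<close> is turned into \<open>x\<close> one coordinate at a time along the
  finite support of \<open>y\<close>; each change scales one coordinate by a factor of modulus at
  most 1.\<close>

lemma N_mono:
  assumes x: "x \<in> c00" and y: "y \<in> c00" and le: "\<And>i. \<bar>x i\<bar> \<le> \<bar>y i\<bar>"
  shows "N x \<le> N y"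
proof -
  define z where "z = (\<lambda>A i. if i \<in> A then x i else y i)"
  have z_c00: "z A \<in> c00" for A
  proof -
    have "{i. z A i \<noteq> 0} \<subseteq> {i. x i \<noteq> 0} \<union> {i. y i \<noteq> 0}" by (auto simp: z_def)
    then have "finite {i. z A i \<noteq> 0}" using x y by (auto simp: c00_def dest: finite_subset)
    then show ?thesis using x y by (simp add: c00_def z_def)
  qed
  have "N (z A) \<le> N y" if "finite A" for A
    using that
  proof (induction A rule: finite_induct)
    case empty
    then show ?case by (simp add: z_def)
  next
    case (insert n A)
    obtain c where c: "\<bar>c\<bar> \<le> 1" "x n = c * y n"
    proof (cases "y n = 0")
      case True
      then show ?thesis using le[of n] that[of 0] by simp
    next
      case False
      then show ?thesis using le[of n] that[of "x n / y n"] by simp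
    qed
    have upd: "z (insert n A) = (z A)(n := c * z A n)"
      using insert c by (auto simp: z_def)
    have "N (z (insert n A)) \<le> N (z A)"
      unfolding upd by (rule N_shrink_coordinate[OF z_c00 c(1)])
    also have "\<dots> \<le> N y" by (rule insert.IH)
    finally show ?case .
  qed
  \<comment> \<open>Off the support of \<open>y\<close> the bound \<open>le\<close> forces
    \<open>x\<close> to vanish as well.\<close>
  moreover have "z {i. y i \<noteq> 0} = x"
  proof
    fix i
    show "z {i. y i \<noteq> 0} i = x i" using le[of i] by (auto simp: z_def)
  qed
  ultimately show ?thesis using y by (force simp: c00_def)
qed

lemma N_restr_mono: "x \<in> c00 \<Longrightarrow> A \<subseteq> B \<Longrightarrow> N (restr x A) \<le> N (restr x B)"
  by (intro N_mono restr_c00) (auto simp: restr_def)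

lemma N_restr_le: "x \<in> c00 \<Longrightarrow> N (restr x A) \<le> N x"
  by (intro N_mono restr_c00) (auto simp: restr_def)

lemma N_ind_mono: "finite B \<Longrightarrow> 0 \<notin> B \<Longrightarrow> A \<subseteq> B \<Longrightarrow> N (ind A) \<le> N (ind B)"
  by (intro N_mono ind_c00) (auto simp: ind_def dest: finite_subset)

lemma N_ind_Un_le:
  assumes "finite A" "finite B" "0 \<notin> A" "0 \<notin> B"
  shows "N (ind (A \<union> B)) \<le> N (ind A) + N (ind B)"
proof -
  have "N (ind (A \<union> B)) \<le> N (\<lambda>i. ind A i + ind B i)"
    using assms ind_c00[of A] ind_c00[of B]
    by (intro N_mono ind_c00)
      (auto simp: ind_def c00_def intro: finite_subset[of _ "A \<union> B"])
  also have "\<dots> \<le> N (ind A) + N (ind B)"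
    using assms by (intro N_add_le ind_c00) auto
  finally show ?thesis .
qed

lemma N_ind_singleton: "1 \<le> n \<Longrightarrow> N (ind {n}) = 1"
  using uncond unfolding normalized_1_unconditional_def unitv_def ind_def by simp

lemma abs_coordinate_le_N:
  assumes "x \<in> c00"
  shows "\<bar>x n\<bar> \<le> N x"
proof (cases "n = 0")
  case True
  then show ?thesis using assms N_nonneg by (simp add: c00_def)
next
  case False
  have "\<bar>x n\<bar> = \<bar>x n\<bar> * N (ind {n})" using N_ind_singleton[of n] False by simp
  also have "\<dots> = N (\<lambda>i. x n * ind {n} i)" using False by (intro N_scale[symmetric] ind_c00) auto
  also have "(\<lambda>i. x n * ind {n} i) = restr x {n}" by (auto simp: restr_def ind_def)
  also have "N \<dots> \<le> N x" using assms by (rule N_restr_le)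
  finally show ?thesis .
qed

lemma psi_mono: "i \<le> j \<Longrightarrow> psi N i \<le> psi N j"
  unfolding psi_def by (intro N_ind_mono) auto

lemma psi_ge_1: "1 \<le> n \<Longrightarrow> 1 \<le> psi N n"
  using psi_mono[of 1 n] N_ind_singleton[of 1] by (simp add: psi_def)

lemma psi_add_le: "psi N (m + n) \<le> psi N m + real n"
proof (induction n)
  case (Suc n)
  have "{1..m + Suc n} = {1..m + n} \<union> {m + Suc n}" by auto
  then have "psi N (m + Suc n) \<le> psi N (m + n) + 1"
    using N_ind_Un_le[of "{1..m+n}" "{m + Suc n}"] N_ind_singleton[of "m + Suc n"]
    by (simp add: psi_def)
  then show ?case using Suc by simp
qed simp

lemma psi_le_real: "psi N n \<le> real n"
  using psi_add_le[of 0 n] N_zero by (simp add: psi_def ind_def)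

lemma psi_interval: "m \<le> n \<Longrightarrow> psi N n - psi N m \<le> N (ind {m<..n})"
proof -
  assume "m \<le> n"
  then have "{1..n} = {1..m} \<union> {m<..n}" by auto
  then show ?thesis using N_ind_Un_le[of "{1..m}" "{m<..n}"] by (simp add: psi_def)
qed

text \<open>An initial segment of \<open>S\<close> grows until its norm first reaches
  \<open>c\<close>. The last point adds at most 1, so the segment has norm at most
  \<open>c + 1\<close>, and the triangle inequality leaves at least \<open>c\<close> for the
  rest.\<close>

lemma balanced_split:
  assumes fin: "finite S" and S0: "0 \<notin> S"
  shows "\<exists>A. (N (ind S) - 1) / 2 \<le> N (ind (S \<inter> A)) \<and> (N (ind S) - 1) / 2 \<le> N (ind (S - A))"
proof -
  define c where "c = (N (ind S) - 1) / 2"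
  define t where "t = (LEAST t. c \<le> N (ind (S \<inter> {..t})))"
  have nonneg: "0 \<le> N (ind S)" using N_nonneg[OF ind_c00[OF fin S0]] .
  have "S \<inter> {..Max (insert 0 S)} = S" using fin by auto
  then have "c \<le> N (ind (S \<inter> {..Max (insert 0 S)}))" using nonneg by (simp add: c_def)
  then have t: "c \<le> N (ind (S \<inter> {..t}))" unfolding t_def by (rule LeastI)
  have "N (ind (S \<inter> {..t})) \<le> c + 1"
  proof (cases t)
    case 0
    then have "S \<inter> {..t} = {}" using S0 by auto
    then have "N (ind (S \<inter> {..t})) = 0" using N_zero by (simp add: ind_def)
    then show ?thesis using nonneg by (simp add: c_def field_simps)
  next
    case (Suc u)
    have "N (ind (S \<inter> {..u})) < c"
      using not_less_Least[of u "\<lambda>t. c \<le> N (ind (S \<inter> {..t}))"] Suc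
      by (simp flip: t_def)
    moreover have "N (ind (S \<inter> {..t})) \<le> N (ind ((S \<inter> {..u}) \<union> {t}))"
      using S0 Suc by (intro N_ind_mono) (auto simp: le_Suc_eq)
    moreover have "\<dots> \<le> N (ind (S \<inter> {..u})) + N (ind {t})"
      using S0 Suc by (intro N_ind_Un_le) auto
    ultimately show ?thesis using N_ind_singleton[of t] Suc by simp
  qed
  moreover have "N (ind ((S \<inter> {..t}) \<union> (S - {..t}))) \<le> N (ind (S \<inter> {..t})) + N (ind (S - {..t}))"
    using fin S0 by (intro N_ind_Un_le) auto
  ultimately have "c \<le> N (ind (S - {..t}))"
    by (simp add: Int_Diff_Un c_def field_simps)
  then show ?thesis using t unfolding c_def by blast
qed

text \<open>Two rounds of halving: 4c + 3 leads to 2c + 1, and this to c.\<close>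

lemma four_way_split:
  assumes fin: "finite S" and S0: "0 \<notin> S" and large: "4 * c + 3 \<le> N (ind S)"
  shows "\<exists>U V. c \<le> N (ind (S \<inter> U \<inter> V)) \<and> c \<le> N (ind (S \<inter> U - V))
    \<and> c \<le> N (ind (S \<inter> V - U)) \<and> c \<le> N (ind (S - U - V))"
proof -
  have split: "\<exists>A. b \<le> N (ind (T \<inter> A)) \<and> b \<le> N (ind (T - A))"
    if "T \<subseteq> S" "2 * b + 1 \<le> N (ind T)" for T b
  proof -
    have "b \<le> (N (ind T) - 1) / 2" using that by simp
    then show ?thesis using balanced_split[of T] that fin S0
      by (meson finite_subset order_trans subsetD)
  qed
  obtain U where U: "2 * c + 1 \<le> N (ind (S \<inter> U))" "2 * c + 1 \<le> N (ind (S - U))"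
    using split[of S "2 * c + 1"] large by auto
  obtain V where V: "c \<le> N (ind (S \<inter> U \<inter> V))" "c \<le> N (ind (S \<inter> U - V))"
    using split[of "S \<inter> U" c] U by auto
  obtain W where W: "c \<le> N (ind ((S - U) \<inter> W))" "c \<le> N (ind (S - U - W))"
    using split[of "S - U" c] U by auto
  \<comment> \<open>The two second cuts are glued along \<open>U\<close> into a single set that
    serves both halves.\<close>
  define V' where "V' = (U \<inter> V) \<union> (W - U)"
  have "S \<inter> U \<inter> V' = S \<inter> U \<inter> V" "S \<inter> U - V' = S \<inter> U - V"
    "S \<inter> V' - U = (S - U) \<inter> W" "S - U - V' = S - U - W"
    unfolding V'_def by auto
  then show ?thesis using V W by metis
qed

text \<open>Only the point \<open>i\<close> of \<open>C\<close> with the largest modulus of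
  \<open>f\<close> matters: \<open>f\<close> on \<open>C\<close> is at most this modulus times
  \<open>ind C\<close>, while \<open>f\<close> has the same modulus on all of
  \<open>E'\<close>.\<close>

lemma level_domination:
  assumes f: "f \<in> c00" and C: "finite C" "0 \<notin> C" and E: "finite E" "0 \<notin> E"
    and R: "0 \<le> R"
    and dom: "\<And>i. i \<in> C \<Longrightarrow> \<exists>E'\<subseteq>E. (\<forall>j\<in>E'. f j = f i) \<and> R * N (ind C) \<le> N (ind E')"
  shows "R * N (restr f C) \<le> N (restr f E)"
proof (cases "C = {}")
  case True
  then show ?thesis using N_zero N_nonneg[OF restr_c00[OF f]] by (simp add: restr_def)
next
  case False
  obtain i where i: "i \<in> C" "\<And>j. j \<in> C \<Longrightarrow> \<bar>f j\<bar> \<le> \<bar>f i\<bar>"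
  proof -
    have "Max ((\<lambda>j. \<bar>f j\<bar>) ` C) \<in> (\<lambda>j. \<bar>f j\<bar>) ` C" using C False by (intro Max_in) auto
    then obtain i where "i \<in> C" "Max ((\<lambda>j. \<bar>f j\<bar>) ` C) = \<bar>f i\<bar>" by auto
    moreover have "\<bar>f j\<bar> \<le> Max ((\<lambda>j. \<bar>f j\<bar>) ` C)" if "j \<in> C" for j using that C by auto
    ultimately show ?thesis using that by simp
  qed
  obtain E' where E': "E' \<subseteq> E" "\<forall>j\<in>E'. f j = f i" "R * N (ind C) \<le> N (ind E')"
    using dom[OF i(1)] by auto
  have finE': "finite E'" "0 \<notin> E'" using E' E by (auto dest: finite_subset)
  have scaled: "(\<lambda>j. f i * ind C j) \<in> c00"
    using C by (auto simp: c00_def ind_def elim: rev_finite_subset)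
  have "N (restr f C) \<le> N (\<lambda>j. f i * ind C j)"
    using i by (intro N_mono restr_c00 f scaled) (auto simp: restr_def ind_def)
  also have "\<dots> = \<bar>f i\<bar> * N (ind C)" by (rule N_scale[OF ind_c00[OF C]])
  finally have "R * N (restr f C) \<le> R * (\<bar>f i\<bar> * N (ind C))"
    using R by (rule mult_left_mono)
  also have "\<dots> \<le> \<bar>f i\<bar> * N (ind E')"
    using mult_left_mono[OF E'(3), of "\<bar>f i\<bar>"] by (simp add: mult_ac)
  also have "\<dots> = N (\<lambda>j. f i * ind E' j)" by (rule N_scale[OF ind_c00[OF finE'], symmetric])
  also have "(\<lambda>j. f i * ind E' j) = restr f E'" using E' by (auto simp: restr_def ind_def)
  also have "N \<dots> \<le> N (restr f E)" by (rule N_restr_mono[OF f E'(1)])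
  finally show ?thesis .
qed

end

section \<open>Restrictions to successive blocks and the lower and upper estimates\<close>

lemma block_seq_restr:
  assumes "f \<in> c00" and "\<And>i j a b. i < j \<Longrightarrow> j < n \<Longrightarrow> a \<in> C i \<Longrightarrow> b \<in> C j \<Longrightarrow> a < b"
  shows "block_seq (map (\<lambda>j. restr f (C j)) [0..<n])"
  unfolding block_seq_def
proof (intro conjI allI impI)
  show "\<forall>x\<in>set (map (\<lambda>j. restr f (C j)) [0..<n]). x \<in> c00"
    using assms(1) by (auto intro: restr_c00)
next
  fix i j a b
  assume "i < j" "j < length (map (\<lambda>j. restr f (C j)) [0..<n])"
    "(map (\<lambda>j. restr f (C j)) [0..<n] ! i) a \<noteq> 0"
    "(map (\<lambda>j. restr f (C j)) [0..<n] ! j) b \<noteq> 0"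
  then show "a < b"
    using assms(2)[of i j a b] by (simp add: restr_def split: if_splits)
qed

lemma vsum_restr:
  assumes "\<And>i j a b. i < j \<Longrightarrow> j < n \<Longrightarrow> a \<in> C i \<Longrightarrow> b \<in> C j \<Longrightarrow> a < (b::nat)"
  shows "vsum (map (\<lambda>j. restr f (C j)) [0..<n]) = restr f (\<Union>j<n. C j)"
proof
  fix i
  have "vsum (map (\<lambda>j. restr f (C j)) [0..<n]) i = (\<Sum>j<n. restr f (C j) i)"
    by (simp add: vsum_def comp_def interv_sum_list_conv_sum_set_nat atLeast0LessThan)
  also have "\<dots> = restr f (\<Union>j<n. C j) i"
  proof (cases "\<exists>j<n. i \<in> C j")
    case True
    then obtain j where j: "j < n" "i \<in> C j" by auto
    have "i \<notin> C j'" if "j' < n" "j' \<noteq> j" for j'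
      using assms[of j j' i i] assms[of j' j i i] that j by (cases j j' rule: linorder_cases) auto
    then have "(\<Sum>j'<n. restr f (C j') i) = (\<Sum>j'<n. if j' = j then f i else 0)"
      using j by (intro sum.cong) (auto simp: restr_def)
    then show ?thesis using j by (auto simp: restr_def)
  next
    case False
    then show ?thesis by (auto simp: restr_def)
  qed
  finally show "vsum (map (\<lambda>j. restr f (C j)) [0..<n]) i = restr f (\<Union>j<n. C j) i" .
qed

locale estimates = unconditional_norm +
  fixes p :: ereal and q :: real
  assumes q: "1 \<le> q" "ereal q \<le> p" and est: "lower_upper_est N p q"
begin

lemma inv_e_le: "inv_e p \<le> 1 / q"
  using q by (cases p) (auto simp: inv_e_def field_simps)

lemma restr_estimates:
  assumes f: "f \<in> c00" and C: "\<And>i j a b. i < j \<Longrightarrow> j < n \<Longrightarrow> a \<in> C i \<Longrightarrow> b \<in> C j \<Longrightarrow> a < b"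
  shows "lpsum p (map (\<lambda>j. N (restr f (C j))) [0..<n]) \<le> N (restr f (\<Union>j<n. C j)) \<and>
    N (restr f (\<Union>j<n. C j)) \<le> lpsum (ereal q) (map (\<lambda>j. N (restr f (C j))) [0..<n])"
proof -
  have "block_seq (map (\<lambda>j. restr f (C j)) [0..<n])"
    by (rule block_seq_restr[OF f]) (rule C)
  moreover have "vsum (map (\<lambda>j. restr f (C j)) [0..<n]) = restr f (\<Union>j<n. C j)"
    by (rule vsum_restr) (rule C)
  ultimately show ?thesis
    using est[unfolded lower_upper_est_def, rule_format, of "map (\<lambda>j. restr f (C j)) [0..<n]"]
    by (simp add: comp_def)
qed

text \<open>The upper q estimate is used on the \<open>C j\<close> and the lower p estimate on the
  \<open>E j\<close>; the passage between the two over at most \<open>d\<close> blocks consumes the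
  extra factor in \<open>dom\<close>.\<close>

lemma chain_domination:
  assumes f: "f \<in> c00" and n: "n \<le> d"
    and C: "\<And>i j a b. i < j \<Longrightarrow> j < n \<Longrightarrow> a \<in> C i \<Longrightarrow> b \<in> C j \<Longrightarrow> a < b"
    and E: "\<And>i j a b. i < j \<Longrightarrow> j < n \<Longrightarrow> a \<in> E i \<Longrightarrow> b \<in> E j \<Longrightarrow> a < b"
    and dom: "\<And>j. j < n \<Longrightarrow>
      c * real d powr (1/q - inv_e p) * N (restr f (C j)) \<le> N (restr f (E j))"
    and c: "0 < c"
  shows "c * N (restr f (\<Union>j<n. C j)) \<le> N (restr f (\<Union>j<n. E j))"
proof (cases "n = 0")
  case True
  then show ?thesis using N_zero by (simp add: restr_def)
next
  case False
  define D where "D = real d powr (1/q - inv_e p)"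
  have D: "0 < D" using False n by (simp add: D_def)
  have nonneg: "0 \<le> N (restr f S)" for S by (intro N_nonneg restr_c00 f)
  have "N (restr f (\<Union>j<n. C j)) \<le> lpsum (ereal q) (map (\<lambda>j. N (restr f (C j))) [0..<n])"
    by (rule restr_estimates[THEN conjunct2]) (fact f C)+
  also have "\<dots> \<le> lpsum (ereal q) (map (\<lambda>j. 1 / (c * D) * N (restr f (E j))) [0..<n])"
    using dom[folded D_def] nonneg q c D
    by (intro lpsum_mono) (simp_all add: pos_le_divide_eq mult.commute)
  also have "\<dots> = 1 / (c * D) * lpsum (ereal q) (map (\<lambda>j. N (restr f (E j))) [0..<n])"
    using c D nonneg q by (intro lpsum_cmult) auto
  also have "\<dots> \<le> 1 / (c * D) * (D * lpsum p (map (\<lambda>j. N (restr f (E j))) [0..<n]))"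
    using c D nonneg q n unfolding D_def by (intro mult_left_mono lpsum_le_lpsum) auto
  also have "\<dots> = 1 / c * lpsum p (map (\<lambda>j. N (restr f (E j))) [0..<n])"
    using D by simp
  also have "lpsum p (map (\<lambda>j. N (restr f (E j))) [0..<n]) \<le> N (restr f (\<Union>j<n. E j))"
    by (rule restr_estimates[THEN conjunct1]) (fact f E)+
  finally show ?thesis using c by (simp add: field_simps)
qed

end

context unconditional_norm
begin

text \<open>Let s be the sum of the norms of \<open>f\<close> on \<open>A\<close> and
  \<open>g\<close> off \<open>A\<close>. Both are at least 3/4, so s is at least 3/2. The remaining
  parts have total norm at most s/3, whence s is at most \<open>2 * N (vdiff f g)\<close> + s/3. The
  factor 3 thus yields exactly 1/2.\<close>

lemma half_le_N_vdiff:
  assumes f: "f \<in> c00" "N f = 1" and g: "g \<in> c00" "N g = 1"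
    and fA: "3 * N (restr f (- A)) \<le> N (restr f A)"
    and gA: "3 * N (restr g A) \<le> N (restr g (- A))"
  shows "1/2 \<le> N (vdiff f g)"
proof -
  have split: "N x \<le> N (restr x A) + N (restr x (- A))" if "x \<in> c00" for x
  proof -
    have "x = (\<lambda>i. restr x A i + restr x (- A) i)" by (auto simp: restr_def)
    then show ?thesis using N_add_le[OF restr_c00[OF that] restr_c00[OF that], of A "- A"] by simp
  qed
  have part: "N (restr x B) \<le> N (vdiff x y) + N (restr y B)" if "x \<in> c00" "y \<in> c00" for x y B
    using N_le_vdiff[of "restr x B" "restr y B"] N_restr_le[OF vdiff_c00, of x y B] that
    by (simp add: restr_c00 restr_vdiff)
  have "N (restr f A) \<le> N (vdiff f g) + N (restr g A)"
    by (rule part) fact+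
  moreover have "N (restr g (- A)) \<le> N (vdiff f g) + N (restr f (- A))"
    using part[OF g(1) f(1), of "- A"] N_vdiff_commute[OF f(1) g(1)] by simp
  ultimately show ?thesis
    using split[OF f(1)] split[OF g(1)] f g fA gA by linarith
qed

end

subsection \<open>Staircases\<close>

text \<open>16 is 8/eps for eps = 1/2. The scales \<open>m\<close> will be a tail of the given
  \<open>kk\<close> for the first claim and a newly built sequence for the second;
  \<open>2 \<le> m 0\<close> makes room for the coordinates 1 and 2.\<close>

locale staircase = estimates +
  fixes d k :: nat and m :: "nat \<Rightarrow> nat"
  assumes d: "2 \<le> d" and m0: "2 \<le> m 0" and k: "m d \<le> k"
    and growth: "\<And>j. j < d \<Longrightarrow>
      (16 * real d powr (1/q - inv_e p) + 2) * psi N (m j) + 1 \<le> psi N (m (Suc j))"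
begin

definition D :: real where "D = real d powr (1/q - inv_e p)"

text \<open>The first block is \<open>[1, l 0]\<close> and carries the four special coordinates \<open>1, 2, 3, 4\<close>,
  although \<open>m 0\<close> may be \<open>2\<close>; the last one, \<open>blk d\<close>, reaches up to \<open>k\<close>.\<close>
definition l :: "nat \<Rightarrow> nat" where "l j = max 4 (m j)"

text \<open>The alternative \<open>j = d\<close> is a default: everything beyond
  \<open>l (d - 1)\<close> falls into the last block.\<close>

definition cc :: "nat \<Rightarrow> nat" where "cc i = (LEAST j. j = d \<or> i \<le> l j)"

definition blk :: "nat \<Rightarrow> nat set" where "blk j = {i \<in> {1..k}. cc i = j}"

lemma D_ge_1: "1 \<le> D"
  unfolding D_def using d inv_e_le by (intro ge_one_powr_ge_zero) auto

lemma psi_m: "j \<le> d \<Longrightarrow> 1 \<le> psi N (m j) \<and> 2 \<le> m j"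
proof (induction j)
  case 0
  then show ?case using m0 psi_ge_1[of "m 0"] by simp
next
  case (Suc j)
  have "18 * 1 \<le> (16 * D + 2) * psi N (m j)"
    using Suc D_ge_1 by (intro mult_mono) auto
  then have "19 \<le> psi N (m (Suc j))" using growth[of j] Suc by (simp flip: D_def)
  then show ?case using psi_le_real[of "m (Suc j)"] by simp
qed

lemma psi_m_Suc: "j < d \<Longrightarrow> 18 * psi N (m j) + 1 \<le> psi N (m (Suc j))"
proof -
  assume j: "j < d"
  have "18 * psi N (m j) \<le> (16 * D + 2) * psi N (m j)"
    using j D_ge_1 psi_m[of j] by (intro mult_right_mono) auto
  then show ?thesis using growth[OF j] by (simp flip: D_def)
qed

text \<open>Since \<open>psi N n\<close> is at most \<open>n\<close>, growth of \<open>psi\<close>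
  along \<open>m\<close> forces growth of \<open>m\<close> itself; as 19 exceeds 4, the maximum in
  \<open>l\<close> can only matter at index 0.\<close>

lemma m_Suc: "j < d \<Longrightarrow> 19 \<le> m (Suc j) \<and> m j < m (Suc j)"
proof -
  assume j: "j < d"
  have "19 \<le> psi N (m (Suc j))" "psi N (m j) < psi N (m (Suc j))"
    using psi_m_Suc[OF j] psi_m[of j] j by auto
  then show ?thesis
    using psi_le_real[of "m (Suc j)"] psi_mono[of "m (Suc j)" "m j"] by force
qed

lemma l_pos: "0 < j \<Longrightarrow> j \<le> d \<Longrightarrow> l j = m j"
  using m_Suc[of "j - 1"] by (cases j) (auto simp: l_def)

lemma l_Suc: "j < d \<Longrightarrow> l j < l (Suc j)"
  using m_Suc[of j] by (auto simp: l_def)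

lemma l_mono: "i \<le> j \<Longrightarrow> j \<le> d \<Longrightarrow> l i \<le> l j"
proof (induction j rule: dec_induct)
  case (step n)
  then show ?case using l_Suc[of n] by simp
qed simp

lemma l_ge_4: "4 \<le> l j"
  by (simp add: l_def)

lemma k_gt: "l (d - 1) < k"
  using l_Suc[of "d - 1"] l_pos[of d] d k by simp

lemma cc_le: "cc i \<le> d"
  unfolding cc_def by (rule Least_le) simp

lemma cc_le_iff: "j < d \<Longrightarrow> cc i \<le> j \<longleftrightarrow> i \<le> l j"
proof
  assume j: "j < d" "cc i \<le> j"
  have "cc i = d \<or> i \<le> l (cc i)"
    unfolding cc_def by (rule LeastI[of "\<lambda>j. j = d \<or> i \<le> l j" d]) simp
  then show "i \<le> l j" using j l_mono[of "cc i" j] by auto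
next
  assume "j < d" "i \<le> l j"
  then show "cc i \<le> j" unfolding cc_def by (intro Least_le) simp
qed

lemma cc_mono: "i \<le> j \<Longrightarrow> cc i \<le> cc j"
  using cc_le_iff[of "cc j" j] cc_le_iff[of "cc j" i] cc_le[of i] cc_le[of j]
  by (cases "cc j = d") auto

lemma less_if_cc_less: "cc i < cc j \<Longrightarrow> i < j"
  using cc_mono[of j i] by (cases "i < j") auto

lemma cc_small: "i \<le> 4 \<Longrightarrow> cc i = 0"
  using cc_le_iff[of 0 i] d l_ge_4[of 0] by simp

lemma cc_k: "cc k = d"
  using cc_le_iff[of "d - 1" k] cc_le[of k] k_gt d by simp

lemma cc_pos_gt_4: "0 < cc i \<Longrightarrow> 4 < i"
  using cc_small[of i] by (cases "i \<le> 4") auto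

lemma finite_blk: "finite (blk j)" "0 \<notin> blk j"
  by (auto simp: blk_def)

lemma blk_subset: "j < d \<Longrightarrow> blk j \<subseteq> {1..l j}"
  by (auto simp: blk_def simp flip: cc_le_iff)

text \<open>The bound has the form \<open>4 * c + 3\<close> with
  \<open>c = 3 * D * psi N (m j)\<close>, as \<open>four_way_split\<close> demands. Growth leaves
  \<open>16 * D * psi N (m j)\<close>, and \<open>D * psi N (m j)\<close> is at least 1.\<close>

lemma blk_large:
  assumes j: "j < d"
  shows "12 * D * psi N (m j) + 3 \<le> N (ind (blk (Suc j)))"
proof -
  define u where "u = (if Suc j = d then k else l (Suc j))"
  have "i \<in> blk (Suc j) \<longleftrightarrow> l j < i \<and> i \<le> u" for i
  proof (cases "Suc j = d")
    case True
    then show ?thesis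
      using cc_le_iff[of j i] cc_le[of i] j by (auto simp: blk_def u_def)
  next
    case False
    then have "Suc j < d" using j by simp
    moreover have "l (Suc j) \<le> k" using l_mono[of "Suc j" "d - 1"] \<open>Suc j < d\<close> k_gt by linarith
    ultimately show ?thesis
      using cc_le_iff[of j i] cc_le_iff[of "Suc j" i] j by (auto simp: blk_def u_def)
  qed
  then have blk: "blk (Suc j) = {l j<..u}" by (simp add: set_eq_iff)
  have mu: "m (Suc j) \<le> u"
  proof (cases "Suc j = d")
    case True
    then show ?thesis using k by (simp add: u_def)
  next
    case False
    then show ?thesis by (simp add: u_def l_def)
  qed
  \<comment> \<open>The maximum with 4 adds at most two coordinates because \<open>m j\<close> is at
    least 2; they cost at most 2 in norm.\<close>
  have "l j \<le> m j + 2" using psi_m[of j] j by (auto simp: l_def)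
  then have "psi N (l j) \<le> psi N (m j) + 2"
    using psi_mono[of "l j" "m j + 2"] psi_add_le[of "m j" 2] by simp
  moreover have "psi N (m (Suc j)) \<le> psi N u" by (rule psi_mono[OF mu])
  moreover have "l j \<le> u"
    using l_Suc[OF j] mu l_pos[of "Suc j"] j by simp
  ultimately have "psi N (m (Suc j)) - psi N (m j) - 2 \<le> N (ind (blk (Suc j)))"
    using psi_interval[of "l j" u] unfolding blk by linarith
  moreover have "(16 * D + 2) * psi N (m j) + 1 \<le> psi N (m (Suc j))"
    using growth[OF j] by (simp flip: D_def)
  moreover have "1 * 1 \<le> D * psi N (m j)"
    using D_ge_1 psi_m[of j] j by (intro mult_mono) auto
  ultimately show ?thesis using psi_m[of j] j by (simp add: algebra_simps)
qed

lemma blk_split: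
  "\<exists>U V. \<forall>j<d. 3 * D * psi N (m j) \<le> N (ind (blk (Suc j) \<inter> U \<inter> V))
    \<and> 3 * D * psi N (m j) \<le> N (ind (blk (Suc j) \<inter> U - V))
    \<and> 3 * D * psi N (m j) \<le> N (ind (blk (Suc j) \<inter> V - U))
    \<and> 3 * D * psi N (m j) \<le> N (ind (blk (Suc j) - U - V))"
proof -
  have "\<exists>U V. 3 * D * psi N (m j) \<le> N (ind (blk (Suc j) \<inter> U \<inter> V))
    \<and> 3 * D * psi N (m j) \<le> N (ind (blk (Suc j) \<inter> U - V))
    \<and> 3 * D * psi N (m j) \<le> N (ind (blk (Suc j) \<inter> V - U))
    \<and> 3 * D * psi N (m j) \<le> N (ind (blk (Suc j) - U - V))" if "j < d" for j
    using blk_large[OF that] by (intro four_way_split finite_blk) simp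
  then obtain U V where UV: "\<And>j. j < d \<Longrightarrow> 3 * D * psi N (m j) \<le> N (ind (blk (Suc j) \<inter> U j \<inter> V j))
    \<and> 3 * D * psi N (m j) \<le> N (ind (blk (Suc j) \<inter> U j - V j))
    \<and> 3 * D * psi N (m j) \<le> N (ind (blk (Suc j) \<inter> V j - U j))
    \<and> 3 * D * psi N (m j) \<le> N (ind (blk (Suc j) - U j - V j))"
    by metis
  \<comment> \<open>The sets chosen for block \<open>Suc j\<close> carry the index \<open>j\<close>,
    hence \<open>cc i - 1\<close>.\<close>
  define U' V' where "U' = {i. i \<in> U (cc i - 1)}" and "V' = {i. i \<in> V (cc i - 1)}"
  have "blk (Suc j) \<inter> U' \<inter> V' = blk (Suc j) \<inter> U j \<inter> V j"
    "blk (Suc j) \<inter> U' - V' = blk (Suc j) \<inter> U j - V j"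
    "blk (Suc j) \<inter> V' - U' = blk (Suc j) \<inter> V j - U j"
    "blk (Suc j) - U' - V' = blk (Suc j) - U j - V j" for j
    by (auto simp: blk_def U'_def V'_def)
  then show ?thesis using UV by metis
qed

end

section \<open>Two competing staircases and the concentration of images\<close>

locale split_staircase = staircase +
  fixes U V :: "nat set" and e :: nat
  assumes split: "\<And>j. j < d \<Longrightarrow> 3 * D * psi N (m j) \<le> N (ind (blk (Suc j) \<inter> U \<inter> V))"
    "\<And>j. j < d \<Longrightarrow> 3 * D * psi N (m j) \<le> N (ind (blk (Suc j) \<inter> U - V))"
    "\<And>j. j < d \<Longrightarrow> 3 * D * psi N (m j) \<le> N (ind (blk (Suc j) \<inter> V - U))"
    "\<And>j. j < d \<Longrightarrow> 3 * D * psi N (m j) \<le> N (ind (blk (Suc j) - U - V))"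
    and e: "e = 3 \<or> e = 4"
begin

text \<open>\<open>U\<close> contains the leading halves and \<open>V\<close> the positive parts. The coordinates
  \<open>1\<close> and \<open>2\<close> are the top levels \<open>\<plusminus>1\<close> of \<open>w\<close>. Only the single coordinate \<open>e\<close> is raised to
  the top level of \<open>w'\<close>: raising both \<open>3\<close> and \<open>4\<close> would give a set of norm up to \<open>2\<close>, too
  large compared to \<open>psi N (m 0)\<close>. Hence \<open>e\<close> is chosen according to the sign of the zero \<open>v\<close>
  on the curve, while \<open>w\<close> does not depend on \<open>e\<close>.\<close>
definition sg :: "nat \<Rightarrow> real" where
  "sg i = (if i = 1 \<or> i = 3 \<or> 4 < i \<and> i \<in> V then 1 else -1)"

text \<open>Number of steps of length 1/d below the top; \<open>d\<close> means the value 0, taken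
  on the last block and on what block 0 contains beyond 4.\<close>

definition a :: "nat \<Rightarrow> nat" where
  "a i = (if i \<le> 2 then 0 else if i \<le> 4 then 1 else if cc i = 0 \<or> cc i = d then d
    else if i \<in> U then cc i else Suc (cc i))"

definition a' :: "nat \<Rightarrow> nat" where
  "a' i = (if i \<le> 2 then 1 else if i = e then 0 else if i \<le> 4 then 2
    else if cc i = 0 \<or> cc i = d then d
    else if i \<in> U then Suc (cc i) else cc i)"

definition w :: "nat \<Rightarrow> real" where "w i = sg i * (1 - real (a i) / real d)"

definition w' :: "nat \<Rightarrow> real" where "w' i = sg i * (1 - real (a' i) / real d)"

text \<open>\<open>7 - e\<close> is the other one of 3 and 4.\<close>

definition A :: "nat set" where "A = {1, 2, 7 - e} \<union> {i. 0 < cc i \<and> cc i < d \<and> i \<in> U}"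

lemma a_le: "a i \<le> d" "a' i \<le> d"
  using d cc_le[of i] by (auto simp: a_def a'_def)

lemma w_le: "\<bar>w i\<bar> \<le> 1" "\<bar>w' i\<bar> \<le> 1"
  using a_le[of i] d by (auto simp: w_def w'_def sg_def abs_mult)

lemma w_close: "\<bar>w i - w' i\<bar> \<le> 1 / real d"
proof -
  have "\<bar>real (a i) - real (a' i)\<bar> \<le> 1"
    using e by (auto simp: a_def a'_def)
  moreover have "w i - w' i = sg i * ((real (a' i) - real (a i)) / real d)"
    by (simp add: w_def w'_def algebra_simps diff_divide_distrib)
  ultimately show ?thesis using d
    by (auto simp: abs_mult sg_def divide_right_mono)
qed

lemma w_values: "w 1 = 1" "w 2 = -1" "w' e = (if e = 3 then 1 else -1)" "w k = 0"
  using e d cc_k k_gt l_ge_4[of "d - 1"] by (auto simp: w_def w'_def a_def a'_def sg_def)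

lemma e_le_k: "e \<le> k" "2 \<le> k"
  using k_gt l_ge_4[of "d - 1"] e by auto

text \<open>A nonzero value of \<open>w\<close> or \<open>w'\<close> consists of a height and a
  sign, so each half must have large norm within either sign.\<close>

lemma same_sign_part:
  assumes j: "j < d"
  shows "3 * D * psi N (m j) \<le> N (ind {i' \<in> blk (Suc j) \<inter> U. sg i' = sg i})"
    "3 * D * psi N (m j) \<le> N (ind {i' \<in> blk (Suc j) - U. sg i' = sg i})"
proof -
  have gt: "4 < i'" if "i' \<in> blk (Suc j)" for i'
    using that cc_pos_gt_4[of i'] by (simp add: blk_def)
  have sgn: "i' \<in> blk (Suc j) \<Longrightarrow> sg i' = (if i' \<in> V then 1 else -1)" for i'
    using gt[of i'] by (auto simp: sg_def)
  have "{i' \<in> blk (Suc j) \<inter> U. sg i' = sg i}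
      = (if sg i = 1 then blk (Suc j) \<inter> U \<inter> V else blk (Suc j) \<inter> U - V)"
    "{i' \<in> blk (Suc j) - U. sg i' = sg i}
      = (if sg i = 1 then blk (Suc j) \<inter> V - U else blk (Suc j) - U - V)"
    using sgn by (auto simp: sg_def[of i] split: if_splits)
  then show "3 * D * psi N (m j) \<le> N (ind {i' \<in> blk (Suc j) \<inter> U. sg i' = sg i})"
    "3 * D * psi N (m j) \<le> N (ind {i' \<in> blk (Suc j) - U. sg i' = sg i})"
    using split[OF j] by simp_all
qed

text \<open>Off \<open>A\<close>, the support of \<open>f\<close> is contained in \<open>e\<close>
  and the lagging halves of the blocks 1, ..., d - 2, because \<open>w\<close> is 0 at all other
  points up to \<open>k\<close>. Each \<open>C j\<close> has the same height as the leading half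
  \<open>E j\<close> of the next block.\<close>

lemma concentrated_on_A:
  assumes f: "f \<in> Xk k" and const: "\<And>i j. i \<in> {1..k} \<Longrightarrow> j \<in> {1..k} \<Longrightarrow> w i = w j \<Longrightarrow> f i = f j"
    and fk: "f k = 0"
  shows "3 * N (restr f (- A)) \<le> N (restr f A)"
proof -
  define C where "C = (\<lambda>j. if j = 0 then {e} else blk j - U)"
  define E where "E = (\<lambda>j. blk (Suc j) \<inter> U)"
  note f00 = Xk_c00[OF f]
  \<comment> \<open>\<open>w k = 0\<close>, so \<open>f k = 0\<close> propagates to the whole zero
    level of \<open>w\<close>.\<close>
  have zero: "f i = 0" if "a i = d" for i
  proof (cases "i \<in> {1..k}")
    case True
    have "w i = w k" using w_values(4) that d by (simp add: w_def)
    then show ?thesis using const[OF True, of k] fk e_le_k by simp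
  next
    case False
    then show ?thesis using f by (simp add: Xk_def)
  qed
  have cc_C: "cc i = j" if "i \<in> C j" for i j
    using that e cc_small[of e] by (auto simp: C_def blk_def split: if_splits)
  have a_C: "a i = Suc j" "i \<in> {1..k}" if "i \<in> C j" "j < d - 1" for i j
    using that e e_le_k cc_pos_gt_4[of i]
    by (auto simp: C_def blk_def a_def split: if_splits)
  have a_E: "a i = Suc j" "i \<in> {1..k}" if "i \<in> E j" "j < d - 1" for i j
    using that cc_pos_gt_4[of i] by (auto simp: E_def blk_def a_def)
  have C_fin: "finite (C j)" "0 \<notin> C j" for j
    using finite_blk[of j] e by (auto simp: C_def)
  \<comment> \<open>For \<open>j = 0\<close> this is the place where a single raised coordinate, of
    norm 1, is affordable.\<close>
  have C_small: "N (ind (C j)) \<le> psi N (m j)" if "j < d - 1" for j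
  proof (cases "j = 0")
    case True
    then show ?thesis using N_ind_singleton[of e] e psi_m[of 0] by (auto simp: C_def)
  next
    case False
    then have "C j \<subseteq> {1..m j}"
      using blk_subset[of j] that l_pos[of j] by (force simp: C_def)
    then show ?thesis unfolding psi_def by (intro N_ind_mono) auto
  qed
  have "3 * N (restr f (\<Union>j<d-1. C j)) \<le> N (restr f (\<Union>j<d-1. E j))"
  proof (rule chain_domination[OF f00, of "d - 1" d])
    fix i j b c
    assume "i < j" "b \<in> C i" "c \<in> C j"
    then show "b < c" using cc_C less_if_cc_less[of b c] by metis
  next
    fix i j b c
    assume "i < j" "b \<in> E i" "c \<in> E j"
    then show "b < c" using less_if_cc_less[of b c] by (simp add: E_def blk_def)
  next
    fix j
    assume j: "j < d - 1"
    have "3 * D * N (restr f (C j)) \<le> N (restr f (E j))"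
    proof (rule level_domination[OF f00 C_fin])
      fix i
      assume i: "i \<in> C j"
      let ?E = "{i' \<in> blk (Suc j) \<inter> U. sg i' = sg i}"
      have "f i' = f i" if "i' \<in> ?E" for i'
      proof -
        have "i' \<in> E j" using that by (auto simp: E_def)
        then have "w i' = w i" using a_C(1)[OF i j] a_E(1)[OF _ j] that by (simp add: w_def)
        then show ?thesis using const a_C(2)[OF i j] a_E(2)[OF \<open>i' \<in> E j\<close> j] by blast
      qed
      moreover have "3 * D * N (ind (C j)) \<le> 3 * D * psi N (m j)"
        using C_small[OF j] D_ge_1 by (intro mult_left_mono) auto
      moreover have "3 * D * psi N (m j) \<le> N (ind ?E)"
        using same_sign_part(1)[of j i] j by simp
      moreover have "?E \<subseteq> E j" by (auto simp: E_def)
      ultimately show "\<exists>E'\<subseteq>E j. (\<forall>i'\<in>E'. f i' = f i) \<and> 3 * D * N (ind (C j)) \<le> N (ind E')"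
        by (meson order_trans)
    qed (use finite_blk D_ge_1 in \<open>auto simp: E_def\<close>)
    then show "3 * real d powr (1/q - inv_e p) * N (restr f (C j)) \<le> N (restr f (E j))"
      by (simp add: D_def)
  qed auto
  moreover have "N (restr f (- A)) \<le> N (restr f (\<Union>j<d-1. C j))"
  proof (intro N_mono restr_c00 f00)
    fix i
    have "i \<in> (\<Union>j<d-1. C j)" if i: "i \<notin> A" "f i \<noteq> 0"
    proof -
      have "i \<in> {1..k}" using i f by (auto simp: Xk_def)
      have "a i \<noteq> d" using zero i by auto
      show ?thesis
      proof (cases "i \<le> 4")
        case True
        then have "i = e" using i(1) \<open>i \<in> {1..k}\<close> e by (auto simp: A_def)
        then show ?thesis using d by (auto simp: C_def intro!: bexI[of _ 0])
      next
        case False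
        then have "0 < cc i" "cc i < d" "i \<notin> U" "Suc (cc i) \<noteq> d"
          using \<open>a i \<noteq> d\<close> i(1) cc_le[of i] by (auto simp: a_def A_def split: if_splits)
        then show ?thesis
          using \<open>i \<in> {1..k}\<close> by (auto simp: C_def blk_def intro!: bexI[of _ "cc i"])
      qed
    qed
    then show "\<bar>restr f (- A) i\<bar> \<le> \<bar>restr f (\<Union>j<d-1. C j) i\<bar>"
      by (auto simp: restr_def)
  qed
  moreover have "N (restr f (\<Union>j<d-1. E j)) \<le> N (restr f A)"
    by (rule N_restr_mono[OF f00]) (auto simp: E_def A_def blk_def)
  ultimately show ?thesis by linarith
qed

text \<open>Here \<open>g\<close> may be nonzero on the zero level of \<open>w'\<close>, which
  contains the part of block d - 1 in \<open>U\<close>. That part is dominated by the whole last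
  block, so the chain has \<open>d\<close> links instead of \<open>d - 1\<close>.\<close>

lemma concentrated_off_A:
  assumes g: "g \<in> Xk k" and const: "\<And>i j. i \<in> {1..k} \<Longrightarrow> j \<in> {1..k} \<Longrightarrow> w' i = w' j \<Longrightarrow> g i = g j"
  shows "3 * N (restr g A) \<le> N (restr g (- A))"
proof -
  \<comment> \<open>\<open>7 - e\<close> joins \<open>C 1\<close> because \<open>w'\<close> puts it
    two steps below the top.\<close>
  define C where "C = (\<lambda>j. if j = 0 then {1, 2} else blk j \<inter> U \<union> (if j = 1 then {7 - e} else {}))"
  define E where "E = (\<lambda>j. if Suc j = d then blk d else blk (Suc j) - U)"
  note g00 = Xk_c00[OF g]
  have a_C: "a' i = Suc j" "i \<in> {1..k}" if "i \<in> C j" "j < d" for i j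
    using that e e_le_k(2) k_gt l_ge_4[of "d - 1"] cc_pos_gt_4[of i]
    by (auto simp: C_def blk_def a'_def split: if_splits)
  have a_E: "a' i = Suc j" "i \<in> {1..k}" if "i \<in> E j" "j < d" for i j
    using that e cc_pos_gt_4[of i] by (auto simp: E_def blk_def a'_def split: if_splits)
  have C_fin: "finite (C j)" "0 \<notin> C j" for j
    using finite_blk[of j] e by (auto simp: C_def)
  have C_small: "N (ind (C j)) \<le> psi N (m j)" if "j < d" for j
  proof -
    have "C j \<subseteq> {1..m j}"
      using blk_subset[of j] that l_pos[of j] l_ge_4[of j] m0 e
      by (cases "j = 0") (auto simp: C_def split: if_splits)
    then show ?thesis unfolding psi_def by (intro N_ind_mono) auto
  qed
  have "3 * N (restr g (\<Union>j<d. C j)) \<le> N (restr g (\<Union>j<d. E j))"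
  proof (rule chain_domination[OF g00, of d d])
    fix i j b c
    assume ij: "i < j" "b \<in> C i" "c \<in> C j"
    show "b < c"
    proof (cases "i = 0")
      case True
      then show ?thesis
        using ij e cc_pos_gt_4[of c] by (auto simp: C_def blk_def split: if_splits)
    next
      case False
      \<comment> \<open>Equality can fail for \<open>b = 7 - e\<close>, which lies in block 0 but in
        \<open>C 1\<close>; \<open>c\<close> is not affected since \<open>j\<close> is at least
        2.\<close>
      then have "cc b \<le> i" "cc c = j"
        using ij e cc_small[of b] by (auto simp: C_def blk_def split: if_splits)
      then show ?thesis using less_if_cc_less[of b c] ij by simp
    qed
  next
    fix i j b c
    assume "i < j" "b \<in> E i" "c \<in> E j"
    then show "b < c"
      using less_if_cc_less[of b c] by (auto simp: E_def blk_def split: if_splits)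
  next
    fix j
    assume j: "j < d"
    have "3 * D * N (restr g (C j)) \<le> N (restr g (E j))"
    proof (rule level_domination[OF g00 C_fin])
      fix i
      assume i: "i \<in> C j"
      \<comment> \<open>At height \<open>d\<close> the value of \<open>w'\<close> is 0 for either
        sign, so the whole last block is available; at the other heights the signs must
        agree.\<close>
      define E' where "E' = {i' \<in> E j. Suc j = d \<or> sg i' = sg i}"
      have "g i' = g i" if "i' \<in> E'" for i'
      proof -
        have i': "i' \<in> E j" using that by (auto simp: E'_def)
        then have "w' i' = w' i"
          using a_C(1)[OF i j] a_E(1)[OF i' j] that d by (auto simp: w'_def E'_def)
        then show ?thesis using const a_C(2)[OF i j] a_E(2)[OF i' j] by blast
      qed
      moreover have "3 * D * N (ind (C j)) \<le> 3 * D * psi N (m j)"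
        using C_small[OF j] D_ge_1 by (intro mult_left_mono) auto
      moreover have "3 * D * psi N (m j) \<le> N (ind E')"
      proof (cases "Suc j = d")
        case True
        have "1 * 1 \<le> D * psi N (m j)"
          using D_ge_1 psi_m[of j] j by (intro mult_mono) auto
        then show ?thesis using True blk_large[OF j] by (simp add: E'_def E_def)
      next
        case False
        then show ?thesis using same_sign_part(2)[OF j, of i] by (simp add: E'_def E_def)
      qed
      moreover have "E' \<subseteq> E j" by (auto simp: E'_def)
      ultimately show "\<exists>E'\<subseteq>E j. (\<forall>i'\<in>E'. g i' = g i) \<and> 3 * D * N (ind (C j)) \<le> N (ind E')"
        by (meson order_trans)
    qed (use finite_blk D_ge_1 in \<open>auto simp: E_def\<close>)
    then show "3 * real d powr (1/q - inv_e p) * N (restr g (C j)) \<le> N (restr g (E j))"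
      by (simp add: D_def)
  qed auto
  moreover have "N (restr g A) \<le> N (restr g (\<Union>j<d. C j))"
  proof (intro N_mono restr_c00 g00)
    fix i
    have "i \<in> (\<Union>j<d. C j)" if i: "i \<in> A" "g i \<noteq> 0"
    proof -
      have "i \<in> {1..k}" using i g by (auto simp: Xk_def)
      then consider "i \<in> C 0" | "i \<in> C 1" | "0 < cc i" "cc i < d" "i \<in> C (cc i)"
        using i(1) by (auto simp: A_def C_def blk_def)
      then show ?thesis using d by cases auto
    qed
    then show "\<bar>restr g A i\<bar> \<le> \<bar>restr g (\<Union>j<d. C j) i\<bar>"
      by (auto simp: restr_def)
  qed
  moreover have "N (restr g (\<Union>j<d. E j)) \<le> N (restr g (- A))"
    using e cc_small by (intro N_restr_mono[OF g00]) (auto simp: E_def A_def blk_def split: if_splits)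
  ultimately show ?thesis by linarith
qed

end

subsection \<open>A path in the sphere\<close>

lemma abs_le_supn:
  assumes "x \<in> Xk k"
  shows "\<bar>x i\<bar> \<le> supn x"
proof -
  have "range (\<lambda>i. \<bar>x i\<bar>) \<subseteq> insert 0 ((\<lambda>i. \<bar>x i\<bar>) ` {1..k})"
  proof clarify
    fix i
    assume "\<bar>x i\<bar> \<notin> (\<lambda>i. \<bar>x i\<bar>) ` {1..k}"
    then have "i \<notin> {1..k}" by blast
    then show "\<bar>x i\<bar> = 0" using assms by (simp add: Xk_def)
  qed
  then have "finite (range (\<lambda>i. \<bar>x i\<bar>))" by (rule finite_subset) simp
  then show ?thesis unfolding supn_def by (intro cSup_upper bdd_above_finite) auto
qed

lemma supn_le: "(\<And>i. \<bar>x i\<bar> \<le> c) \<Longrightarrow> supn x \<le> c"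
  unfolding supn_def by (intro cSup_least) auto

lemma S_linf_I:
  assumes "x \<in> Xk k" "\<And>i. \<bar>x i\<bar> \<le> 1" "\<bar>x i\<bar> = 1"
  shows "x \<in> S_linf k"
  using supn_le[of x 1] abs_le_supn[of x k i] assms by (auto simp: S_linf_def)

definition sphere_path :: "nat \<Rightarrow> (nat \<Rightarrow> real) \<Rightarrow> real \<Rightarrow> nat \<Rightarrow> real" where
  "sphere_path k w v = (\<lambda>i. if i \<in> {1..k} then v + (1 - \<bar>v\<bar>) * w i else 0)"

lemma sphere_path_Xk: "sphere_path k w v \<in> Xk k"
  by (auto simp: sphere_path_def Xk_def)

text \<open>At a coordinate where \<open>w\<close> is the sign s of \<open>v\<close>, the path has
  the value v + (1 - |v|) s = s. This is why \<open>w\<close> must attain both signs for the full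
  path to stay in the sphere.\<close>

lemma sphere_path_S_linf:
  assumes w: "\<And>i. \<bar>w i\<bar> \<le> 1" and v: "\<bar>v\<bar> \<le> 1"
    and i: "i \<in> {1..k}" "w i = (if 0 \<le> v then 1 else -1)"
  shows "sphere_path k w v \<in> S_linf k"
proof (rule S_linf_I[OF sphere_path_Xk])
  fix j
  have "\<bar>(1 - \<bar>v\<bar>) * w j\<bar> \<le> (1 - \<bar>v\<bar>) * 1"
    unfolding abs_mult using v w[of j] by (intro mult_mono) auto
  then have "\<bar>v + (1 - \<bar>v\<bar>) * w j\<bar> \<le> 1"
    using abs_triangle_ineq[of v "(1 - \<bar>v\<bar>) * w j"] by simp
  then show "\<bar>sphere_path k w v j\<bar> \<le> 1" by (simp add: sphere_path_def)
next
  show "\<bar>sphere_path k w v i\<bar> = 1" using i v by (auto simp: sphere_path_def)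
qed

lemma sphere_path_close:
  assumes "\<And>i. \<bar>w i - w' i\<bar> \<le> c" "\<bar>v\<bar> \<le> 1"
  shows "supn (vdiff (sphere_path k w v) (sphere_path k w' v)) \<le> c"
proof (rule supn_le)
  fix i
  have c: "0 \<le> c" using assms(1)[of i] by linarith
  have "\<bar>(1 - \<bar>v\<bar>) * (w i - w' i)\<bar> \<le> 1 * c"
    unfolding abs_mult using assms by (intro mult_mono) auto
  then show "\<bar>vdiff (sphere_path k w v) (sphere_path k w' v) i\<bar> \<le> c"
    using c by (simp add: vdiff_def sphere_path_def algebra_simps)
qed

lemma sphere_path_lipschitz:
  assumes w: "\<And>i. \<bar>w i\<bar> \<le> 1"
  shows "supn (vdiff (sphere_path k w u) (sphere_path k w v)) \<le> 2 * \<bar>u - v\<bar>"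
proof (rule supn_le)
  fix i
  have "\<bar>(\<bar>v\<bar> - \<bar>u\<bar>) * w i\<bar> \<le> \<bar>u - v\<bar> * 1"
    unfolding abs_mult using w[of i] by (intro mult_mono) auto
  then have "\<bar>u - v + (\<bar>v\<bar> - \<bar>u\<bar>) * w i\<bar> \<le> 2 * \<bar>u - v\<bar>"
    using abs_triangle_ineq[of "u - v" "(\<bar>v\<bar> - \<bar>u\<bar>) * w i"] by simp
  then show "\<bar>vdiff (sphere_path k w u) (sphere_path k w v) i\<bar> \<le> 2 * \<bar>u - v\<bar>"
    by (simp add: vdiff_def sphere_path_def algebra_simps)
qed

lemma ind_S_linf:
  assumes "1 \<le> k"
  shows "ind {1..k} \<in> S_linf k" "(\<lambda>i. - ind {1..k} i) \<in> S_linf k"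
  using assms by (auto intro!: S_linf_I[of _ k 1] simp: Xk_def ind_def)

lemma step_preservingD:
  "step_preserving k F \<Longrightarrow> x \<in> S_linf k \<Longrightarrow> i \<in> {1..k} \<Longrightarrow> j \<in> {1..k} \<Longrightarrow> x i = x j \<Longrightarrow> F x i = F x j"
  unfolding step_preserving_def by blast

section \<open>Modulus of continuity and zeros along the path\<close>

context unconditional_norm
begin

lemma S_X_c00: "x \<in> S_X N k \<Longrightarrow> x \<in> c00"
  by (auto simp: S_X_def intro: Xk_c00)

lemma le_omega:
  assumes F: "F ` S_linf k \<subseteq> S_X N k" and x: "x \<in> S_linf k" and y: "y \<in> S_linf k"
    and close: "supn (vdiff x y) \<le> t"
  shows "N (vdiff (F x) (F y)) \<le> omega N k F t"
  unfolding omega_def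
proof (rule cSup_upper)
  show "bdd_above {N (vdiff (F x) (F y)) |x y. x \<in> S_linf k \<and> y \<in> S_linf k \<and> supn (vdiff x y) \<le> t}"
  \<comment> \<open>Points of the unit sphere are at most 2 apart; boundedness makes
    \<open>Sup\<close> a genuine supremum.\<close>
  proof (rule bdd_aboveI[of _ 2], clarify)
    fix x y
    assume "x \<in> S_linf k" "y \<in> S_linf k"
    then have "F x \<in> S_X N k" "F y \<in> S_X N k" using F by auto
    then show "N (vdiff (F x) (F y)) \<le> 2"
      using N_vdiff_le[of "F x" "F y"] S_X_c00 by (auto simp: S_X_def)
  qed
qed (use x y close in blast)

text \<open>Both images are constant on [1,k] by step preservation. Norm 1 fixes the modulus of the
  constant as 1 / \<open>psi N k\<close>, so distinct images differ in sign.\<close>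

lemma constant_images:
  assumes F: "F ` S_linf k \<subseteq> S_X N k" and step: "step_preserving k F" and k: "1 \<le> k"
    and ne: "F (ind {1..k}) \<noteq> F (\<lambda>i. - ind {1..k} i)"
  shows "F (\<lambda>i. - ind {1..k} i) = (\<lambda>i. - F (ind {1..k}) i)" "F (ind {1..k}) k \<noteq> 0"
proof -
  define f g where "f = F (ind {1..k})" and "g = F (\<lambda>i. - ind {1..k} i)"
  note S = ind_S_linf[OF k]
  have fg: "f \<in> S_X N k" "g \<in> S_X N k" using F S by (auto simp: f_def g_def)
  have const: "x = (\<lambda>i. x k * ind {1..k} i)" if "x \<in> S_X N k" "\<And>i. i \<in> {1..k} \<Longrightarrow> x i = x k" for x
  proof
    fix i
    show "x i = x k * ind {1..k} i"
    proof (cases "i \<in> {1..k}")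
      case True
      then show ?thesis using that(2)[OF True] by (simp add: ind_def)
    next
      case False
      then show ?thesis using that(1) by (auto simp: S_X_def Xk_def ind_def)
    qed
  qed
  have level: "F x i = F x k" if "x \<in> S_linf k" "i \<in> {1..k}" "x i = x k" for x i
    using that k by (intro step_preservingD[OF step]) auto
  have f: "f = (\<lambda>i. f k * ind {1..k} i)"
  proof (rule const[OF fg(1)])
    fix i
    assume "i \<in> {1..k}"
    then show "f i = f k" unfolding f_def by (intro level S) (auto simp: ind_def)
  qed
  have g: "g = (\<lambda>i. g k * ind {1..k} i)"
  proof (rule const[OF fg(2)])
    fix i
    assume "i \<in> {1..k}"
    then show "g i = g k" unfolding g_def by (intro level S) (auto simp: ind_def)
  qed
  have abs: "\<bar>x k\<bar> * psi N k = 1" if "x \<in> S_X N k" "x = (\<lambda>i. x k * ind {1..k} i)" for x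
    using that N_scale[OF ind_c00, of "{1..k}" "x k"] by (simp add: psi_def S_X_def)
  have abs_eq: "\<bar>f k\<bar> * psi N k = 1" "\<bar>g k\<bar> * psi N k = 1" using abs fg f g by auto
  then have "\<bar>f k\<bar> = \<bar>g k\<bar>"
    using psi_ge_1[OF k] by (metis mult_cancel_right zero_neq_one mult_zero_right)
  moreover have "f k \<noteq> g k" using f g ne unfolding f_def g_def by metis
  ultimately have "g k = - f k" by linarith
  then have "g = (\<lambda>i. - f i)" using f g by (metis mult_minus_left)
  then show "F (\<lambda>i. - ind {1..k} i) = (\<lambda>i. - F (ind {1..k}) i)" by (simp add: f_def g_def)
  show "F (ind {1..k}) k \<noteq> 0" using abs_eq(1) by (auto simp: f_def)
qed

text \<open>Intermediate value theorem for the last coordinate of the image: at v = 1 and v = -1 the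
  contribution of \<open>w\<close> disappears and the two values are opposite.\<close>

lemma zero_on_path:
  assumes F: "F ` S_linf k \<subseteq> S_X N k" and step: "step_preserving k F" and cont: "cont_map N k F"
    and ne: "F (ind {1..k}) \<noteq> F (\<lambda>i. - ind {1..k} i)"
    and w: "\<And>i. \<bar>w i\<bar> \<le> 1" "i \<in> {1..k}" "w i = 1" "j \<in> {1..k}" "w j = -1"
  obtains v where "\<bar>v\<bar> \<le> 1" "F (sphere_path k w v) k = 0"
proof -
  define \<phi> where "\<phi> = (\<lambda>v. F (sphere_path k w v) k)"
  have k: "1 \<le> k" using w by auto
  have path: "sphere_path k w v \<in> S_linf k" if "v \<in> {-1..1}" for v
    using that sphere_path_S_linf[of w v i] sphere_path_S_linf[of w v j] w
    by (cases "0 \<le> v") auto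
  have "sphere_path k w 1 = ind {1..k}" "sphere_path k w (-1) = (\<lambda>i. - ind {1..k} i)"
    by (auto simp: sphere_path_def ind_def)
  then have ends: "\<phi> (-1) = - \<phi> 1" using constant_images(1)[OF F step k ne] by (simp add: \<phi>_def)
  have cont_\<phi>: "continuous_on {-1..1} \<phi>"
    unfolding continuous_on_iff
  proof (intro ballI allI impI)
    fix u \<epsilon> :: real
    assume u: "u \<in> {-1..1}" and "0 < \<epsilon>"
    then obtain \<delta> where \<delta>: "0 < \<delta>"
      "\<And>y. y \<in> S_linf k \<Longrightarrow> supn (vdiff (sphere_path k w u) y) < \<delta> \<Longrightarrow> N (vdiff (F (sphere_path k w u)) (F y)) < \<epsilon>"
      using cont path[OF u] unfolding cont_map_def by metis
    show "\<exists>d>0. \<forall>v\<in>{-1..1}. dist v u < d \<longrightarrow> dist (\<phi> v) (\<phi> u) < \<epsilon>"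
    \<comment> \<open>The path is Lipschitz with constant 2.\<close>
    proof (intro exI[of _ "\<delta>/2"] conjI ballI impI)
      fix v :: real
      assume v: "v \<in> {-1..1}" "dist v u < \<delta>/2"
      have "supn (vdiff (sphere_path k w u) (sphere_path k w v)) < \<delta>"
        using sphere_path_lipschitz[of w k u v] w(1) v(2) by (simp add: dist_real_def abs_minus_commute)
      then have "N (vdiff (F (sphere_path k w u)) (F (sphere_path k w v))) < \<epsilon>"
        using \<delta>(2) path[OF v(1)] by blast
      moreover have "vdiff (F (sphere_path k w u)) (F (sphere_path k w v)) \<in> c00"
        using F path[OF u] path[OF v(1)] by (intro vdiff_c00 S_X_c00) auto
      ultimately have "\<bar>vdiff (F (sphere_path k w u)) (F (sphere_path k w v)) k\<bar> < \<epsilon>"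
        using abs_coordinate_le_N by (meson le_less_trans)
      then show "dist (\<phi> v) (\<phi> u) < \<epsilon>"
        by (simp add: \<phi>_def vdiff_def dist_real_def abs_minus_commute)
    qed (use \<delta> in simp)
  qed
  have "\<exists>v\<ge>-1. v \<le> 1 \<and> \<phi> v = 0"
  proof (cases "0 \<le> \<phi> 1")
    case True
    then show ?thesis using IVT'[of \<phi> "-1" 0 1] cont_\<phi> ends by auto
  next
    case False
    then show ?thesis using IVT2'[of \<phi> 1 0 "-1"] cont_\<phi> ends by auto
  qed
  then show ?thesis using that unfolding \<phi>_def by force
qed

text \<open>The three hops join points whose images are at distance 2, so one of them moves the
  image by at least 2/3.\<close>

lemma omega_1_ge_half:
  assumes F: "F ` S_linf k \<subseteq> S_X N k" and step: "step_preserving k F" and k: "2 \<le> k"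
    and ne: "F (ind {1..k}) \<noteq> F (\<lambda>i. - ind {1..k} i)"
  shows "1/2 \<le> omega N k F 1"
proof -
  define x where "x = ind {1..k}"
  define y where "y = ind {1}"
  define y' where "y' = (\<lambda>i. - ind {2..k} i)"
  define x' where "x' = (\<lambda>i. - ind {1..k} i)"
  have S: "x \<in> S_linf k" "x' \<in> S_linf k" using ind_S_linf k by (auto simp: x_def x'_def)
  have S': "y \<in> S_linf k" "y' \<in> S_linf k"
    using k by (auto intro!: S_linf_I[of y k 1] S_linf_I[of y' k 2])
      (auto simp: y_def y'_def Xk_def ind_def)
  have X: "F x \<in> S_X N k" "F x' \<in> S_X N k" "F y \<in> S_X N k" "F y' \<in> S_X N k"
    using S S' F by auto
  have close: "N (vdiff (F x) (F y)) \<le> omega N k F 1" "N (vdiff (F y) (F y')) \<le> omega N k F 1"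
    "N (vdiff (F y') (F x')) \<le> omega N k F 1"
    by (intro le_omega[OF F] S S' supn_le; auto simp: vdiff_def x_def x'_def y_def y'_def ind_def)+
  have "vdiff (F x) (F x') = (\<lambda>i. 2 * F x i)"
    using constant_images(1)[OF F step _ ne] k by (simp add: vdiff_def x_def x'_def fun_eq_iff)
  then have "N (vdiff (F x) (F x')) = 2"
    using N_scale[of "F x" 2] X(1) S_X_c00[OF X(1)] by (simp add: S_X_def)
  moreover have "N (vdiff (F x) (F x')) \<le> N (vdiff (F x) (F y)) + N (vdiff (F y) (F x'))"
    "N (vdiff (F y) (F x')) \<le> N (vdiff (F y) (F y')) + N (vdiff (F y') (F x'))"
    using X by (auto intro!: N_vdiff_triangle S_X_c00)
  ultimately show ?thesis using close by linarith
qed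

end

section \<open>The lower bound for \<open>omega\<close> and the final assembly\<close>

context estimates
begin

lemma omega_ge_half:
  assumes d: "2 \<le> d" and m0: "2 \<le> m 0" and k: "m d \<le> k"
    and growth: "\<And>j. j < d \<Longrightarrow>
      (16 * real d powr (1/q - inv_e p) + 2) * psi N (m j) + 1 \<le> psi N (m (Suc j))"
    and F: "F ` S_linf k \<subseteq> S_X N k" and step: "step_preserving k F" and cont: "cont_map N k F"
    and ne: "F (ind {1..k}) \<noteq> F (\<lambda>i. - ind {1..k} i)"
  shows "1/2 \<le> omega N k F (1 / real d)"
proof -
  interpret staircase N p q d k m
    by unfold_locales (use assms in auto)
  obtain U V where UV: "\<And>e. e = 3 \<or> e = 4 \<Longrightarrow> split_staircase N p q d k m U V e"
  proof -
    obtain U V where "\<forall>j<d. 3 * D * psi N (m j) \<le> N (ind (blk (Suc j) \<inter> U \<inter> V))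
      \<and> 3 * D * psi N (m j) \<le> N (ind (blk (Suc j) \<inter> U - V))
      \<and> 3 * D * psi N (m j) \<le> N (ind (blk (Suc j) \<inter> V - U))
      \<and> 3 * D * psi N (m j) \<le> N (ind (blk (Suc j) - U - V))"
      using blk_split by blast
    then have "split_staircase N p q d k m U V e" if "e = 3 \<or> e = 4" for e
      using that by unfold_locales auto
    then show ?thesis using that by blast
  qed
  \<comment> \<open>The choice \<open>e = 3\<close> is provisional: \<open>w\<close> is the same for
    both values of \<open>e\<close>, so the zero found here remains valid after \<open>e\<close> is
    fixed.\<close>
  interpret S3: split_staircase N p q d k m U V 3 by (rule UV) simp
  obtain v where v: "\<bar>v\<bar> \<le> 1" "F (sphere_path k S3.w v) k = 0"
    using zero_on_path[OF F step cont ne, of S3.w 1 2] S3.w_le(1) S3.w_values S3.e_le_k by auto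
  \<comment> \<open>\<open>w' e\<close> gets the sign of \<open>v\<close>, which keeps
    \<open>y\<close> in the sphere.\<close>
  define e :: nat where "e = (if 0 \<le> v then 3 else 4)"
  interpret S: split_staircase N p q d k m U V e by (rule UV) (simp add: e_def)
  define x y where "x = sphere_path k S.w v" and "y = sphere_path k S.w' v"
  have x: "x \<in> S_linf k"
    unfolding x_def
  proof (rule sphere_path_S_linf[OF S.w_le(1) v(1), of "if 0 \<le> v then 1 else 2"])
  qed (use S.e_le_k S.w_values in auto)
  have y: "y \<in> S_linf k"
    unfolding y_def using S.e_le_k S.w_values S.e
    by (intro sphere_path_S_linf[OF S.w_le(2) v(1), of e]) (auto simp: e_def)
  have "F x \<in> S_X N k" "F y \<in> S_X N k" using F x y by blast+
  then have Xk: "F x \<in> Xk k" "F y \<in> Xk k" and N1: "N (F x) = 1" "N (F y) = 1"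
    by (simp_all add: S_X_def)
  have "1/2 \<le> N (vdiff (F x) (F y))"
  proof (rule half_le_N_vdiff)
    show "3 * N (restr (F x) (- S.A)) \<le> N (restr (F x) S.A)"
    proof (rule S.concentrated_on_A)
      show "F x i = F x j" if "i \<in> {1..k}" "j \<in> {1..k}" "S.w i = S.w j" for i j
        by (rule step_preservingD[OF step x that(1,2)]) (use that in \<open>simp add: x_def sphere_path_def\<close>)
    qed (use Xk v(2) in \<open>simp_all add: x_def\<close>)
    show "3 * N (restr (F y) S.A) \<le> N (restr (F y) (- S.A))"
    proof (rule S.concentrated_off_A)
      show "F y i = F y j" if "i \<in> {1..k}" "j \<in> {1..k}" "S.w' i = S.w' j" for i j
        by (rule step_preservingD[OF step y that(1,2)]) (use that in \<open>simp add: y_def sphere_path_def\<close>)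
    qed (rule Xk)
  qed (use N1 Xk_c00[OF Xk(1)] Xk_c00[OF Xk(2)] in simp_all)
  also have "\<dots> \<le> omega N k F (1 / real d)"
    unfolding x_def y_def
    using x y by (intro le_omega[OF F] sphere_path_close[OF S.w_close v(1)]) (auto simp: x_def y_def)
  finally show ?thesis .
qed

end

theorem theorem5p1:
  fixes N :: "(nat \<Rightarrow> real) \<Rightarrow> real" and p :: ereal and q :: real
    and d :: nat and P :: "nat set" and kk :: "nat \<Rightarrow> nat"
  assumes "norm_on_c00 N"
    and "normalized_1_unconditional N"
    and "\<not> equiv_c0 N"
    and "1 \<le> q" and "ereal q \<le> p"
    and "lower_upper_est N p q"
    and "d \<ge> 1"
    and "assumptionA N p q d (1/2) P kk"
  shows "(\<forall>k F. k > kk (2*d) \<longrightarrow> step_preserving k F \<longrightarrow> F ` S_linf k \<subseteq> S_X N k \<longrightarrow>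
            cont_map N k F \<longrightarrow> F (ind {1..k}) \<noteq> F (\<lambda>i. - ind {1..k} i) \<longrightarrow>
            omega N k F (1 / real d) \<ge> 1/2)
       \<and> \<not> (\<exists>FF :: nat \<Rightarrow> (nat \<Rightarrow> real) \<Rightarrow> (nat \<Rightarrow> real).
              (\<forall>k\<ge>1. homeo_spheres N k (FF k) \<and> step_preserving k (FF k)) \<and>
              (\<forall>e>0. \<exists>\<delta>>0. \<forall>k\<ge>1. omega N k (FF k) \<delta> < e))"
proof -
  interpret estimates N p q
    by unfold_locales (use assms in auto)
  have kk: "\<And>j. 1 \<le> j \<Longrightarrow> kk j < kk (Suc j)"
    and meets: "\<And>j. 1 \<le> j \<Longrightarrow> {kk j<..kk (Suc j)} \<inter> P \<noteq> {} \<and> {kk j<..kk (Suc j)} - P \<noteq> {}"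
    and growth: "\<And>j. 1 \<le> j \<Longrightarrow>
      (16 * real d powr (1/q - inv_e p) + 2) * psi N (kk j) + 1 \<le> psi N (kk (Suc j))"
    using assms(8) unfolding assumptionA_def by auto
  \<comment> \<open>The interval from \<open>kk 1\<close> to \<open>kk 2\<close> contains a point of
    \<open>P\<close> and a point off \<open>P\<close>, hence two distinct positive integers.\<close>
  have kk_2: "2 \<le> kk 2"
  proof -
    obtain a b where "a \<in> {kk 1<..kk 2} \<inter> P" "b \<in> {kk 1<..kk 2} - P"
      using meets[of 1] by (force simp: numeral_2_eq_2)
    then have "a \<noteq> b" "0 < a" "0 < b" "a \<le> kk 2" "b \<le> kk 2" by auto
    then show ?thesis by linarith
  qed
  have kk_mono: "kk i \<le> kk j" if "1 \<le> i" "i \<le> j" for i j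
    using that(2,1) by (induction j rule: dec_induct) (use kk in \<open>auto intro: less_imp_le order_trans\<close>)
  have first: "1/2 \<le> omega N k F (1 / real d)"
    if k: "kk (2 * d) < k" and F: "step_preserving k F" "F ` S_linf k \<subseteq> S_X N k" "cont_map N k F"
      "F (ind {1..k}) \<noteq> F (\<lambda>i. - ind {1..k} i)" for k F
  proof (cases "d = 1")
    case True
    then show ?thesis using omega_1_ge_half[OF F(2,1) _ F(4)] k kk_2 by simp
  next
    case False
    then have d: "2 \<le> d" using assms(7) by simp
    show ?thesis
    \<comment> \<open>The shift by 2 makes \<open>m 0\<close> at least 2, and d + 2 does not exceed
      2d.\<close>
    proof (rule omega_ge_half[where m = "\<lambda>j. kk (j + 2)"])
      show "kk (d + 2) \<le> k" using kk_mono[of "d + 2" "2 * d"] d k by simp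
      show "2 \<le> kk (0 + 2)" using kk_2 by (simp only: add_0)
    qed (use d growth F in auto)
  qed
  \<comment> \<open>By \<open>growth\<close>, \<open>psi\<close> gains at least 1 from each
    \<open>kk j\<close> to the next.\<close>
  have unbounded: "\<exists>n. c \<le> psi N n" for c
  proof -
    have "real j \<le> psi N (kk (Suc j))" for j
    proof (induction j)
      case 0
      then show ?case using N_nonneg[OF ind_c00, of "{1..kk 1}"] by (simp add: psi_def)
    next
      case (Suc j)
      have "1 * psi N (kk (Suc j)) \<le> (16 * real d powr (1/q - inv_e p) + 2) * psi N (kk (Suc j))"
        using Suc by (intro mult_right_mono) auto
      then show ?case using growth[of "Suc j"] Suc by simp
    qed
    then show ?thesis by (meson order_trans real_arch_simple)
  qed
  have second: False
    if FF: "\<And>k. 1 \<le> k \<Longrightarrow> homeo_spheres N k (FF k) \<and> step_preserving k (FF k)"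
      and equi: "\<And>e. 0 < e \<Longrightarrow> \<exists>\<delta>>0. \<forall>k\<ge>1. omega N k (FF k) \<delta> < e"
    for FF :: "nat \<Rightarrow> (nat \<Rightarrow> real) \<Rightarrow> (nat \<Rightarrow> real)"
  proof -
    obtain \<delta> where \<delta>: "0 < \<delta>" "\<And>k. 1 \<le> k \<Longrightarrow> omega N k (FF k) \<delta> < 1/2"
      using equi[of "1/2"] by auto
    obtain n where n: "1 / \<delta> \<le> real n" using real_arch_simple by blast
    \<comment> \<open>\<open>n\<close> alone gives 1/d' at most \<open>\<delta>\<close>; the summand
      2 secures \<open>d'\<close> at least 2.\<close>
    define d' where "d' = n + 2"
    have "1 / \<delta> \<le> real d'" using n by (simp add: d'_def)
    then have d': "1 / real d' \<le> \<delta>" using \<delta>(1) by (simp add: d'_def field_simps)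
    have "\<forall>i. \<exists>n. (16 * real d' powr (1/q - inv_e p) + 2) * psi N i + 1 \<le> psi N n"
      using unbounded by blast
    then obtain step where step: "\<And>i. (16 * real d' powr (1/q - inv_e p) + 2) * psi N i + 1 \<le> psi N (step i)"
      by metis
    \<comment> \<open>The given \<open>kk\<close> is adapted to \<open>d\<close>, not to
      \<open>d'\<close>; iterating \<open>step\<close> from 2 builds scales with the growth needed
      for \<open>d'\<close>.\<close>
    define m where "m = (\<lambda>j. (step ^^ j) 2)"
    define k where "k = max 1 (m d')"
    have k: "1 \<le> k" by (simp add: k_def)
    have F: "bij_betw (FF k) (S_linf k) (S_X N k)" "cont_map N k (FF k)" "step_preserving k (FF k)"
      using FF[OF k] by (auto simp: homeo_spheres_def)
    have image: "FF k ` S_linf k \<subseteq> S_X N k" using F(1) by (simp add: bij_betw_def)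
    have "ind {1..k} \<noteq> (\<lambda>i. - ind {1..k} i)"
      using k by (auto simp: fun_eq_iff ind_def intro!: exI[of _ 1])
    then have ne: "FF k (ind {1..k}) \<noteq> FF k (\<lambda>i. - ind {1..k} i)"
      using F(1) ind_S_linf[OF k] by (auto simp: bij_betw_def dest: inj_onD)
    have "1/2 \<le> omega N k (FF k) (1 / real d')"
      by (rule omega_ge_half[OF _ _ _ _ image F(3,2) ne, where m = m])
        (use step in \<open>auto simp: d'_def m_def k_def\<close>)
    \<comment> \<open>Monotonicity of \<open>omega\<close> in its last argument.\<close>
    moreover have "omega N k (FF k) (1 / real d') \<le> omega N k (FF k) \<delta>"
      unfolding omega_def[of N k "FF k" "1 / real d'"]
    proof (rule cSup_least)
      have "supn (vdiff (ind {1..k}) (ind {1..k})) \<le> 1 / real d'"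
        by (rule supn_le) (simp add: vdiff_def)
      then show "{N (vdiff (FF k x) (FF k y)) |x y.
          x \<in> S_linf k \<and> y \<in> S_linf k \<and> supn (vdiff x y) \<le> 1 / real d'} \<noteq> {}"
        using ind_S_linf(1)[OF k] by blast
    qed (use d' le_omega[OF image] in force)
    ultimately show False using \<delta>(2)[OF k] by linarith
  qed
  show ?thesis using first second by blast
qed

end
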